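(* Let $K>0$ and $\varkappa$ be real functions defined in a domain $\mathcal D\subset\mathbb R^2\equiv\mathbb C$, and let $(K,\varkappa)$ be a solution of the system $$\sqrt[4]{K^2-\varkappa^2}\;\Delta\ln\sqrt[4]{K^2-\varkappa^2}=2K,\qquad \sqrt[4]{K^2-\varkappa^2}\;\Delta\ln\sqrt{\frac{K+\varkappa}{K-\varkappa}}=2\varkappa,\qquad K^2-\varkappa^2>0,\ K>0.\qquad(\mathrm N)$$ Then for any point $p_0\in\mathcal D$ there exist a neighborhood $\mathcal D_0\subset\mathcal D$ of $p_0$ and a pair of holomorphic functions $(g_1,g_2)$ defined in $\mathcal D_0$, satisfying $g_1'g_2'\neq0$ and $(|g_1|^2-1)(|g_2|^2-1)>0$, such that in $\mathcal D_0$ $$K=\frac{8|g_1'g_2'|}{(|g_1|^2-1)(|g_2|^2-1)}\left(\frac{|g_1'|^2}{(|g_1|^2-1)^2}+\frac{|g_2'|^2}{(|g_2|^2-1)^2}\right),$$ $$\varkappa=\frac{-8|g_1'g_2'|}{(|g_1|^2-1)(|g_2|^2-1)}\left(\frac{|g_1'|^2}{(|g_1|^2-1)^2}-\frac{|g_2'|^2}{(|g_2|^2-1)^2}\right).$$ Conversely, if $(g_1,g_2)$ is a pair of holomorphic functions defined in a domain $\mathcal D\subset\mathbb C$ and satisfying $g_1'g_2'\neq0$ and $(|g_1|^2-1)(|g_2|^2-1)>0$, then these formulas give a solution $(K>0,\varkappa)$ of the system $(\mathrm N)$ in $\mathcal D$.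
   Context: $\Delta=\partial_u^2+\partial_v^2$ is the ordinary Laplace operator in $\mathbb R^2$, with $t=u+\mathrm i v$ the complex coordinate; primes denote complex derivatives with respect to $t$. Real functions are assumed smooth. *)

theory Defs
  imports "HOL-Complex_Analysis.Complex_Analysis"
begin

fun continuously_differentiable_on ::
    "nat \<Rightarrow> ('a::euclidean_space \<Rightarrow> 'b::real_normed_vector) \<Rightarrow> 'a set \<Rightarrow> bool" where
  "continuously_differentiable_on 0 f S \<longleftrightarrow> continuous_on S f"
| "continuously_differentiable_on (Suc k) f S \<longleftrightarrow>
     (\<forall>x\<in>S. f differentiable (at x)) \<and>
     (\<forall>v. continuously_differentiable_on k (\<lambda>x. frechet_derivative f (at x) v) S)"

text \<open>Only meaningful for open \<open>S\<close>: the derivatives are taken in the full space.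
  In finite dimension, requiring all directional derivatives of \<open>f\<close> to be of class \<open>C\<^sup>k\<close> is
  the usual recursive description of the class \<open>C\<^sup>k\<^sup>+\<^sup>1\<close>.\<close>

definition smooth_on :: "'a::euclidean_space set \<Rightarrow> ('a \<Rightarrow> 'b::real_normed_vector) \<Rightarrow> bool" where
  "smooth_on S f \<longleftrightarrow> (\<forall>k. continuously_differentiable_on k f S)"

text \<open>The plane is identified with \<^typ>\<open>complex\<close> through \<open>t = u + i v\<close>.\<close>

definition partial_u :: "(complex \<Rightarrow> real) \<Rightarrow> complex \<Rightarrow> real" where
  "partial_u f t = deriv (\<lambda>u. f (Complex u (Im t))) (Re t)"

definition partial_v :: "(complex \<Rightarrow> real) \<Rightarrow> complex \<Rightarrow> real" where
  "partial_v f t = deriv (\<lambda>v. f (Complex (Re t) v)) (Im t)"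

definition laplacian :: "(complex \<Rightarrow> real) \<Rightarrow> complex \<Rightarrow> real" where
  "laplacian f t = partial_u (partial_u f) t + partial_v (partial_v f) t"

definition natural_system_solution ::
    "complex set \<Rightarrow> (complex \<Rightarrow> real) \<Rightarrow> (complex \<Rightarrow> real) \<Rightarrow> bool" where
  "natural_system_solution D K \<kappa> \<longleftrightarrow>
     smooth_on D K \<and> smooth_on D \<kappa> \<and>
     (\<forall>t\<in>D. (K t)\<^sup>2 - (\<kappa> t)\<^sup>2 > 0 \<and> K t > 0 \<and>
       root 4 ((K t)\<^sup>2 - (\<kappa> t)\<^sup>2)
         * laplacian (\<lambda>s. ln (root 4 ((K s)\<^sup>2 - (\<kappa> s)\<^sup>2))) t = 2 * K t \<and>
       root 4 ((K t)\<^sup>2 - (\<kappa> t)\<^sup>2)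
         * laplacian (\<lambda>s. ln (sqrt ((K s + \<kappa> s) / (K s - \<kappa> s)))) t = 2 * \<kappa> t)"

definition K_formula :: "(complex \<Rightarrow> complex) \<Rightarrow> (complex \<Rightarrow> complex) \<Rightarrow> complex \<Rightarrow> real" where
  "K_formula g1 g2 t =
     8 * cmod (deriv g1 t * deriv g2 t) / (((cmod (g1 t))\<^sup>2 - 1) * ((cmod (g2 t))\<^sup>2 - 1))
     * ((cmod (deriv g1 t))\<^sup>2 / ((cmod (g1 t))\<^sup>2 - 1)\<^sup>2
        + (cmod (deriv g2 t))\<^sup>2 / ((cmod (g2 t))\<^sup>2 - 1)\<^sup>2)"

definition kappa_formula :: "(complex \<Rightarrow> complex) \<Rightarrow> (complex \<Rightarrow> complex) \<Rightarrow> complex \<Rightarrow> real" where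
  "kappa_formula g1 g2 t =
     - 8 * cmod (deriv g1 t * deriv g2 t) / (((cmod (g1 t))\<^sup>2 - 1) * ((cmod (g2 t))\<^sup>2 - 1))
     * ((cmod (deriv g1 t))\<^sup>2 / ((cmod (g1 t))\<^sup>2 - 1)\<^sup>2
        - (cmod (deriv g2 t))\<^sup>2 / ((cmod (g2 t))\<^sup>2 - 1)\<^sup>2)"

definition admissible_pair ::
    "complex set \<Rightarrow> (complex \<Rightarrow> complex) \<Rightarrow> (complex \<Rightarrow> complex) \<Rightarrow> bool" where
  "admissible_pair D g1 g2 \<longleftrightarrow>
     g1 holomorphic_on D \<and> g2 holomorphic_on D \<and>
     (\<forall>t\<in>D. deriv g1 t * deriv g2 t \<noteq> 0 \<and>
             ((cmod (g1 t))\<^sup>2 - 1) * ((cmod (g2 t))\<^sup>2 - 1) > 0)"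

end

theory Submission
  imports Defs
begin

text \<open>
  Writing \<open>K \<plusminus> \<kappa>\<close> as exponentials decouples the system: with
  \<open>X = ln (K\<^sup>2 - \<kappa>\<^sup>2) / 4\<close> and \<open>Y = ln ((K + \<kappa>) / (K - \<kappa>)) / 2\<close>, both \<open>w = X + Y\<close> and
  \<open>w = X - Y\<close> satisfy the Liouville equation \<open>\<Delta>w = 2 e\<^sup>w\<close>.

  Locally every solution is \<open>e\<^sup>w = 4 |g'|\<^sup>2 / (1 - |g|\<^sup>2)\<^sup>2\<close>: by the equation
  \<open>S = w\<^sub>t\<^sub>t - w\<^sub>t\<^sup>2 / 2\<close> is holomorphic, and \<open>\<Phi> = e\<^bsup>-w/2\<^esup>\<close> solves \<open>\<Phi>\<^sub>t\<^sub>t = - S/2 \<Phi>\<close> together with the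
  conjugate equation. Solutions \<open>f1, f2\<close> of the holomorphic equation \<open>f'' = - S/2 f\<close> with
  suitable initial values at \<open>p\<close> have Wronskian \<open>1\<close> and make \<open>(|f1|\<^sup>2 - |f2|\<^sup>2) / 2\<close> agree with
  \<open>\<Phi>\<close>, hence \<open>g = f2 / f1\<close> works.
\<close>

section \<open>Functions of class \<open>C\<^sup>k\<close>\<close>

text \<open>The decoupling is exact because \<open>K + \<kappa> = exp (2 * X + Y)\<close>,
  \<open>K - \<kappa> = exp (2 * X - Y)\<close> and the fourth root is \<open>exp X\<close>: adding
  or subtracting the two equations and dividing by the root leaves \<open>exp (X + Y)\<close> or
  \<open>exp (X - Y)\<close>. Here \<open>g1\<close> belongs to \<open>X - Y\<close> and
  \<open>g2\<close> to \<open>X + Y\<close>. The obstacle is that \<open>w\<close> is merely real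
  and smooth, while \<open>g\<close> must be holomorphic. For \<open>S\<close>, the conjugate
  derivatives of its two terms are both \<open>exp w\<close> times half the
  \<open>t\<close>-derivative of \<open>w\<close>, so they cancel; seeing this requires exchanging
  the order of derivatives of \<open>w\<close>, hence the symmetry of second derivatives. The
  comparison of \<Phi> with the function built from \<open>f1\<close> and \<open>f2\<close> rests on
  uniqueness for the pair of linear equations: a solution is determined by four numbers at
  \<open>p\<close>, namely its value, its two first Wirtinger derivatives and its mixed derivative.
  Since \<Phi> is positive, \<open>f1\<close> dominates \<open>f2\<close>, so the construction
  always lands in the unit disc, and for a pair built this way both factors in the sign condition
  are negative.\<close>

lemma frechet_derivative_transform_open:
  assumes "open S" "x \<in> S" "f differentiable (at x)" "\<And>x. x \<in> S \<Longrightarrow> f x = g x"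
  shows "(g has_derivative frechet_derivative f (at x)) (at x)"
    and "frechet_derivative g (at x) = frechet_derivative f (at x)"
proof -
  show *: "(g has_derivative frechet_derivative f (at x)) (at x)"
    using assms by (auto intro!: has_derivative_transform_within_open[of f _ x UNIV S g]
        simp: frechet_derivative_works)
  show "frechet_derivative g (at x) = frechet_derivative f (at x)"
    using frechet_derivative_at[OF *] by simp
qed

text \<open>Since \<open>S\<close> is open, agreement on \<open>S\<close> is agreement near each of
  its points, and so it passes to \<open>frechet_derivative\<close> at every order.\<close>

lemma Ck_cong:
  assumes "open S" "continuously_differentiable_on k f S" "\<And>x. x \<in> S \<Longrightarrow> f x = g x"
  shows "continuously_differentiable_on k g S"
  using assms(2,3)
proof (induction k arbitrary: f g)
  case 0
  then show ?case using continuous_on_cong[of S S f g] by simp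
next
  case (Suc k)
  have f: "f differentiable (at x)" if "x \<in> S" for x
    using Suc.prems(1) that by simp
  note d = frechet_derivative_transform_open[OF \<open>open S\<close> _ f Suc.prems(2)]
  have "continuously_differentiable_on k (\<lambda>x. frechet_derivative g (at x) v) S" for v
  proof (rule Suc.IH)
    show "continuously_differentiable_on k (\<lambda>x. frechet_derivative f (at x) v) S"
      using Suc.prems(1) by simp
    show "frechet_derivative f (at x) v = frechet_derivative g (at x) v" if "x \<in> S" for x
      using d(2)[OF that that] by simp
  qed
  moreover have "g differentiable (at x)" if "x \<in> S" for x
    using d(1)[OF that that] by (rule differentiableI)
  ultimately show ?case by simp
qed

text \<open>Uniqueness of the derivative lets any explicit formula \<open>f'\<close> stand in for
  \<open>frechet_derivative\<close>; the closure properties below take their induction step in this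
  form.\<close>

lemma Ck_Suc:
  assumes "open S" "\<And>x. x \<in> S \<Longrightarrow> (f has_derivative f' x) (at x)"
    and "\<And>v. continuously_differentiable_on k (\<lambda>x. f' x v) S"
  shows "continuously_differentiable_on (Suc k) f S"
proof -
  have eq: "f' x v = frechet_derivative f (at x) v" if "x \<in> S" for x v
    using frechet_derivative_at[OF assms(2)[OF that]] by simp
  have "continuously_differentiable_on k (\<lambda>x. frechet_derivative f (at x) v) S" for v
    using Ck_cong[OF assms(1) assms(3) eq] .
  moreover have "f differentiable (at x)" if "x \<in> S" for x
    using assms(2)[OF that] by (rule differentiableI)
  ultimately show ?thesis by simp
qed

lemma Ck_SucD:
  assumes "continuously_differentiable_on (Suc k) f S"
  shows "x \<in> S \<Longrightarrow> (f has_derivative frechet_derivative f (at x)) (at x)"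
    and "continuously_differentiable_on k (\<lambda>x. frechet_derivative f (at x) v) S"
  using assms frechet_derivative_works by auto

lemma Ck_lower: "continuously_differentiable_on (Suc k) f S \<Longrightarrow> continuously_differentiable_on k f S"
proof (induction k arbitrary: f)
  case 0
  then have "\<forall>x\<in>S. isCont f x"
    using differentiable_imp_continuous_within by auto
  then show ?case
    using continuous_at_imp_continuous_on by auto
next
  case (Suc k)
  from Suc.IH[OF Ck_SucD(2)[OF Suc.prems]] Ck_SucD(1)[OF Suc.prems] show ?case
    by (auto intro: differentiableI)
qed

lemma Ck_const:
  assumes "open S"
  shows "continuously_differentiable_on k (\<lambda>x. c) S"
proof (induction k arbitrary: c)
  case (Suc k)
  then show ?case by (intro Ck_Suc[OF assms, where f'="\<lambda>x v. 0"]) auto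
qed auto

lemma Ck_add:
  assumes "open S"
  shows "continuously_differentiable_on k f S \<Longrightarrow> continuously_differentiable_on k g S
    \<Longrightarrow> continuously_differentiable_on k (\<lambda>x. f x + g x) S"
proof (induction k arbitrary: f g)
  case 0
  then show ?case by (auto intro: continuous_intros)
next
  case (Suc k)
  obtain f' where f': "\<And>x. x \<in> S \<Longrightarrow> (f has_derivative f' x) (at x)"
    "\<And>v. continuously_differentiable_on k (\<lambda>x. f' x v) S"
    using that[of "\<lambda>x. frechet_derivative f (at x)"] Ck_SucD[OF Suc.prems(1)] by blast
  obtain g' where g': "\<And>x. x \<in> S \<Longrightarrow> (g has_derivative g' x) (at x)"
    "\<And>v. continuously_differentiable_on k (\<lambda>x. g' x v) S"
    using that[of "\<lambda>x. frechet_derivative g (at x)"] Ck_SucD[OF Suc.prems(2)] by blast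
  show ?case
    by (rule Ck_Suc[OF assms has_derivative_add[OF f'(1) g'(1)]]) (assumption | rule Suc.IH[OF f'(2) g'(2)])+
qed

lemma Ck_bounded_linear:
  assumes "open S" "bounded_linear L"
  shows "continuously_differentiable_on k f S \<Longrightarrow> continuously_differentiable_on k (\<lambda>x. L (f x)) S"
proof (induction k arbitrary: f)
  case 0
  then show ?case using assms by (auto intro: bounded_linear.continuous_on)
next
  case (Suc k)
  obtain f' where f': "\<And>x. x \<in> S \<Longrightarrow> (f has_derivative f' x) (at x)"
    "\<And>v. continuously_differentiable_on k (\<lambda>x. f' x v) S"
    using that[of "\<lambda>x. frechet_derivative f (at x)"] Ck_SucD[OF Suc.prems(1)] by blast
  show ?case
    by (rule Ck_Suc[OF assms(1) bounded_linear.has_derivative[OF assms(2) f'(1)]]) (assumption | rule Suc.IH[OF f'(2)])+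
qed

text \<open>The product rule multiplies a differentiated factor by an undifferentiated one;
  \<open>Ck_lower\<close> brings the latter down to order \<open>k\<close> so that the induction
  hypothesis applies.\<close>

lemma Ck_mult:
  fixes f g :: "'a::euclidean_space \<Rightarrow> 'b::real_normed_algebra"
  assumes "open S"
  shows "continuously_differentiable_on k f S \<Longrightarrow> continuously_differentiable_on k g S
    \<Longrightarrow> continuously_differentiable_on k (\<lambda>x. f x * g x) S"
proof (induction k arbitrary: f g)
  case 0
  then show ?case by (auto intro: continuous_intros)
next
  case (Suc k)
  obtain f' where f': "\<And>x. x \<in> S \<Longrightarrow> (f has_derivative f' x) (at x)"
    "\<And>v. continuously_differentiable_on k (\<lambda>x. f' x v) S"
    using that[of "\<lambda>x. frechet_derivative f (at x)"] Ck_SucD[OF Suc.prems(1)] by blast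
  obtain g' where g': "\<And>x. x \<in> S \<Longrightarrow> (g has_derivative g' x) (at x)"
    "\<And>v. continuously_differentiable_on k (\<lambda>x. g' x v) S"
    using that[of "\<lambda>x. frechet_derivative g (at x)"] Ck_SucD[OF Suc.prems(2)] by blast
  show ?case
  proof (rule Ck_Suc[OF assms])
    show "((\<lambda>x. f x * g x) has_derivative (\<lambda>v. f x * g' x v + f' x v * g x)) (at x)" if "x \<in> S" for x
      using has_derivative_mult[OF f'(1)[OF that] g'(1)[OF that]] .
    show "continuously_differentiable_on k (\<lambda>x. f x * g' x v + f' x v * g x) S" for v
      by (rule Ck_add[OF assms Suc.IH[OF Ck_lower[OF Suc.prems(1)] g'(2)]
            Suc.IH[OF f'(2) Ck_lower[OF Suc.prems(2)]]])
  qed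
qed

text \<open>By the chain rule the derivative in direction \<open>v\<close> is \<open>f' x v\<close>
  times the composition of \<open>\<lambda>y. g' y 1\<close> with \<open>f\<close>. The inner
  function stays the same, so the induction generalises only over \<open>g\<close>.\<close>

lemma Ck_compose_real:
  fixes f :: "'a::euclidean_space \<Rightarrow> real" and g :: "real \<Rightarrow> real"
  assumes "open S" "open T" "f ` S \<subseteq> T"
  shows "continuously_differentiable_on k g T \<Longrightarrow> continuously_differentiable_on k f S
    \<Longrightarrow> continuously_differentiable_on k (\<lambda>x. g (f x)) S"
proof (induction k arbitrary: g)
  case 0
  then show ?case using assms(3) continuous_on_compose2[of T g S f] by simp
next
  case (Suc k)
  obtain f' where f': "\<And>x. x \<in> S \<Longrightarrow> (f has_derivative f' x) (at x)"
    "\<And>v. continuously_differentiable_on k (\<lambda>x. f' x v) S"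
    using that[of "\<lambda>x. frechet_derivative f (at x)"] Ck_SucD[OF Suc.prems(2)] by blast
  obtain g' where g': "\<And>x. x \<in> T \<Longrightarrow> (g has_derivative g' x) (at x)"
    "\<And>v. continuously_differentiable_on k (\<lambda>x. g' x v) T"
    using that[of "\<lambda>x. frechet_derivative g (at x)"] Ck_SucD[OF Suc.prems(1)] by blast
  have "((\<lambda>x. g (f x)) has_derivative (\<lambda>v. f' x v * g' (f x) 1)) (at x)" if "x \<in> S" for x
  proof -
    have "f x \<in> T" using that assms(3) by auto
    then have "linear (g' (f x))" using g'(1) has_derivative_linear by blast
    then have lin: "g' (f x) c = c * g' (f x) 1" for c :: real
      using linear_scale[of "g' (f x)" c 1] by (metis mult.right_neutral real_scaleR_def)
    have "((\<lambda>x. g (f x)) has_derivative (\<lambda>v. g' (f x) (f' x v))) (at x)"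
      using has_derivative_compose[OF f'(1)[OF that] g'(1)[OF \<open>f x \<in> T\<close>]] .
    also have "(\<lambda>v. g' (f x) (f' x v)) = (\<lambda>v. f' x v * g' (f x) 1)"
      by (rule ext, rule lin)
    finally show ?thesis .
  qed
  moreover have "continuously_differentiable_on k (\<lambda>x. f' x v * g' (f x) 1) S" for v
    using Ck_mult[OF assms(1) f'(2) Suc.IH[OF g'(2) Ck_lower[OF Suc.prems(2)]]] .
  ultimately show ?case
    by (rule Ck_Suc[OF assms(1)])
qed

section \<open>Smooth functions: closure properties and basic examples\<close>

lemma smooth_on_const: "open S \<Longrightarrow> smooth_on S (\<lambda>x. c)"
  unfolding smooth_on_def by (rule allI, rule Ck_const)

lemma smooth_on_add:
  "open S \<Longrightarrow> smooth_on S f \<Longrightarrow> smooth_on S g \<Longrightarrow> smooth_on S (\<lambda>x. f x + g x)"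
  unfolding smooth_on_def by (rule allI, rule Ck_add) (assumption | erule spec)+

lemma smooth_on_mult:
  fixes f g :: "'a::euclidean_space \<Rightarrow> 'b::real_normed_algebra"
  shows "open S \<Longrightarrow> smooth_on S f \<Longrightarrow> smooth_on S g \<Longrightarrow> smooth_on S (\<lambda>x. f x * g x)"
  unfolding smooth_on_def by (rule allI, rule Ck_mult) (assumption | erule spec)+

lemma smooth_on_bounded_linear:
  "open S \<Longrightarrow> bounded_linear L \<Longrightarrow> smooth_on S f \<Longrightarrow> smooth_on S (\<lambda>x. L (f x))"
  unfolding smooth_on_def by (rule allI, rule Ck_bounded_linear) (assumption | erule spec)+

lemma smooth_on_diff:
  assumes "open S" "smooth_on S f" "smooth_on S g"
  shows "smooth_on S (\<lambda>x. f x - g x)"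
  using smooth_on_add[OF assms(1,2) smooth_on_bounded_linear[OF assms(1) bounded_linear_minus[OF bounded_linear_ident] assms(3)]]
  unfolding diff_conv_add_uminus .

lemma smooth_on_compose_real:
  fixes f :: "'a::euclidean_space \<Rightarrow> real" and g :: "real \<Rightarrow> real"
  assumes "open S" "open T" "f ` S \<subseteq> T" "smooth_on T g" "smooth_on S f"
  shows "smooth_on S (\<lambda>x. g (f x))"
  unfolding smooth_on_def
  by (rule allI, rule Ck_compose_real[OF assms(1-3) assms(4)[unfolded smooth_on_def, rule_format]
      assms(5)[unfolded smooth_on_def, rule_format]])

lemma smooth_on_cong:
  "open S \<Longrightarrow> smooth_on S f \<Longrightarrow> (\<And>x. x \<in> S \<Longrightarrow> f x = g x) \<Longrightarrow> smooth_on S g"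
  unfolding smooth_on_def by (rule allI, rule Ck_cong) (assumption | erule spec)+

lemma smooth_on_frechet_derivative:
  assumes "smooth_on S f"
  shows "smooth_on S (\<lambda>x. frechet_derivative f (at x) v)"
  unfolding smooth_on_def by (rule allI, rule Ck_SucD(2), rule assms[unfolded smooth_on_def, rule_format])

lemma smooth_on_has_derivative:
  assumes "smooth_on S f" "x \<in> S"
  shows "(f has_derivative frechet_derivative f (at x)) (at x)"
  using Ck_SucD(1)[OF assms(1)[unfolded smooth_on_def, rule_format, of "Suc 0"] assms(2)] .

lemma smooth_on_imp_continuous_on:
  assumes "smooth_on S f"
  shows "continuous_on S f"
  using assms[unfolded smooth_on_def, rule_format, of 0] by simp

lemma smooth_on_exp: "smooth_on UNIV (exp :: real \<Rightarrow> real)"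
proof -
  have "continuously_differentiable_on k (exp :: real \<Rightarrow> real) UNIV" for k
  proof (induction k)
    case (Suc k)
    have "(exp has_derivative (\<lambda>v. v * exp x)) (at x)" for x :: real
      by (rule DERIV_exp[unfolded has_field_derivative_def, THEN has_derivative_eq_rhs]) auto
    moreover have "continuously_differentiable_on k (\<lambda>x::real. v * exp x) UNIV" for v
      by (rule Ck_mult[OF open_UNIV Ck_const[OF open_UNIV] Suc.IH])
    ultimately show ?case
      by (rule Ck_Suc[OF open_UNIV])
  qed (simp add: continuous_on_exp[OF continuous_on_id, simplified])
  then show ?thesis by (simp add: smooth_on_def)
qed

text \<open>The derivative is a multiple of the square of \<open>inverse\<close>, so the induction
  closes on \<open>inverse\<close> itself.\<close>

lemma smooth_on_inverse: "smooth_on {0<..} (inverse :: real \<Rightarrow> real)"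
proof -
  have "continuously_differentiable_on k (inverse :: real \<Rightarrow> real) {0<..}" for k
  proof (induction k)
    case 0
    have "continuous_on {0<..} (inverse :: real \<Rightarrow> real)"
      by (rule continuous_on_inverse[OF continuous_on_id]) auto
    then show ?case by simp
  next
    case (Suc k)
    have "(inverse has_derivative (\<lambda>v. - v * (inverse x * inverse x))) (at x)"
      if "x \<in> {0<..}" for x :: real
      using that by (auto intro!: derivative_eq_intros)
    moreover have "continuously_differentiable_on k (\<lambda>x::real. - v * (inverse x * inverse x)) {0<..}" for v
      by (rule Ck_mult[OF open_greaterThan Ck_const[OF open_greaterThan]
            Ck_mult[OF open_greaterThan Suc.IH Suc.IH]])
    ultimately show ?case
      by (rule Ck_Suc[OF open_greaterThan])
  qed
  then show ?thesis by (simp add: smooth_on_def)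
qed

lemma smooth_on_ln: "smooth_on {0<..} (ln :: real \<Rightarrow> real)"
proof -
  have "continuously_differentiable_on (Suc k) (ln :: real \<Rightarrow> real) {0<..}" for k
  proof (rule Ck_Suc[OF open_greaterThan])
    show "(ln has_derivative (\<lambda>v. v * inverse x)) (at x)" if "x \<in> {0<..}" for x :: real
      using that by (auto intro!: derivative_eq_intros simp: divide_inverse)
    show "continuously_differentiable_on k (\<lambda>x::real. v * inverse x) {0<..}" for v
      using smooth_on_inverse unfolding smooth_on_def
      by (intro Ck_mult[OF open_greaterThan Ck_const[OF open_greaterThan]]) blast
  qed
  then show ?thesis unfolding smooth_on_def using Ck_lower by blast
qed

lemma smooth_on_holomorphic:
  assumes "open S" "f holomorphic_on S"
  shows "smooth_on S f"
proof -
  have "continuously_differentiable_on k f S" for k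
    using assms(2)
  proof (induction k arbitrary: f)
    case 0
    then show ?case by (simp add: holomorphic_on_imp_continuous_on)
  next
    case (Suc k)
    have "(f has_derivative (\<lambda>v. deriv f x * v)) (at x)" if "x \<in> S" for x
      using holomorphic_derivI[OF Suc.prems assms(1) that] by (simp add: has_field_derivative_def)
    moreover have "continuously_differentiable_on k (\<lambda>x. deriv f x * v) S" for v
      by (rule Ck_mult[OF assms(1) Suc.IH[OF holomorphic_deriv[OF Suc.prems assms(1)]] Ck_const[OF assms(1)]])
    ultimately show ?case
      by (rule Ck_Suc[OF assms(1)])
  qed
  then show ?thesis by (simp add: smooth_on_def)
qed

section \<open>Wirtinger derivatives\<close>

text \<open>The mean value theorem is applied twice, in direction \<open>a\<close> and then in
  direction \<open>b\<close>. The second difference on the left is symmetric in \<open>a\<close> and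
  \<open>b\<close>, whereas \<open>R\<close> remembers the order of differentiation.\<close>

lemma mixed_difference_quotient:
  fixes f :: "complex \<Rightarrow> real"
  assumes "s > 0"
    and f: "\<And>x y. x \<in> {0..s} \<Longrightarrow> y \<in> {0..s} \<Longrightarrow>
      ((\<lambda>h. f (p + of_real h * a + of_real y * b)) has_real_derivative P (p + of_real x * a + of_real y * b)) (at x)"
    and P: "\<And>x y. x \<in> {0..s} \<Longrightarrow> y \<in> {0..s} \<Longrightarrow>
      ((\<lambda>h. P (p + of_real x * a + of_real h * b)) has_real_derivative R (p + of_real x * a + of_real y * b)) (at y)"
  obtains x y where "x \<in> {0..s}" "y \<in> {0..s}"
    "f (p + of_real s * a + of_real s * b) - f (p + of_real s * a) - f (p + of_real s * b) + f p
      = s\<^sup>2 * R (p + of_real x * a + of_real y * b)"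
proof -
  let ?\<phi> = "\<lambda>h. f (p + of_real h * a + of_real s * b) - f (p + of_real h * a + of_real 0 * b)"
  have "\<exists>x>0. x < s \<and> ?\<phi> s - ?\<phi> 0 = (s - 0) *
      (P (p + of_real x * a + of_real s * b) - P (p + of_real x * a + of_real 0 * b))"
    using assms(1) by (intro MVT2 DERIV_diff f) auto
  then obtain x where x: "0 < x" "x < s" "?\<phi> s - ?\<phi> 0 = s *
      (P (p + of_real x * a + of_real s * b) - P (p + of_real x * a + of_real 0 * b))"
    by auto
  have "\<exists>y>0. y < s \<and> P (p + of_real x * a + of_real s * b) - P (p + of_real x * a + of_real 0 * b)
      = (s - 0) * R (p + of_real x * a + of_real y * b)"
    using assms(1) x by (intro MVT2 P) auto
  then obtain y where y: "0 < y" "y < s" "P (p + of_real x * a + of_real s * b) - P (p + of_real x * a + of_real 0 * b)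
      = s * R (p + of_real x * a + of_real y * b)"
    by auto
  show ?thesis
    by (rule that[of x y]) (use x y in \<open>auto simp: power2_eq_square algebra_simps\<close>)
qed

lemma has_derivative_along_line:
  fixes f :: "complex \<Rightarrow> real"
  assumes "(f has_derivative f') (at (q + of_real x * a))"
  shows "((\<lambda>h. f (q + of_real h * a)) has_real_derivative f' a) (at x)"
proof -
  have "((\<lambda>h. f (q + of_real h * a)) has_derivative (\<lambda>h. f' (of_real h * a))) (at x)"
    by (rule has_derivative_compose[of "\<lambda>h. q + of_real h * a" _ x UNIV f f', OF _ assms])
      (auto intro!: derivative_eq_intros)
  moreover have "f' (of_real h * a) = f' a * h" for h
    using linear_scale[OF has_derivative_linear[OF assms], of h a]
    by (simp add: scaleR_conv_of_real mult.commute)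
  ultimately show ?thesis by (simp add: has_field_derivative_def mult_commute_abs)
qed

text \<open>Both orders of differentiation represent the same second difference, so
  \<open>D a b\<close> and \<open>D b a\<close> agree at two points arbitrarily close to
  \<open>p\<close>; continuity of both carries the equality to \<open>p\<close>.\<close>

lemma symmetric_second_derivative:
  fixes f :: "complex \<Rightarrow> real"
  assumes "open S" "p \<in> S" "smooth_on S f"
  shows "frechet_derivative (\<lambda>t. frechet_derivative f (at t) a) (at p) b
    = frechet_derivative (\<lambda>t. frechet_derivative f (at t) b) (at p) a"
proof -
  define D where "D a b t = frechet_derivative (\<lambda>t. frechet_derivative f (at t) a) (at t) b" for a b t
  have sm: "smooth_on S (D a b)" for a b
    unfolding D_def by (intro smooth_on_frechet_derivative assms)
  have f: "(f has_derivative frechet_derivative f (at t)) (at t)" if "t \<in> S" for t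
    using smooth_on_has_derivative[OF assms(3) that] .
  have P: "((\<lambda>t. frechet_derivative f (at t) a) has_derivative (\<lambda>b. D a b t)) (at t)" if "t \<in> S" for t a
    unfolding D_def using smooth_on_has_derivative[OF smooth_on_frechet_derivative[OF assms(3)] that] .
  have "\<bar>D a b p - D b a p\<bar> \<le> e" if "e > 0" for e
  proof -
    have e2: "0 < e / 2" using that by simp
    have cont: "isCont (D a b) p" for a b
      using smooth_on_imp_continuous_on[OF sm] assms(1,2) by (simp add: continuous_on_eq_continuous_at)
    obtain d1 where d1: "d1 > 0" "\<And>q. dist q p < d1 \<Longrightarrow> dist (D a b q) (D a b p) < e/2"
      using cont[unfolded continuous_at_eps_delta, rule_format, OF e2] by blast
    obtain d2 where d2: "d2 > 0" "\<And>q. dist q p < d2 \<Longrightarrow> dist (D b a q) (D b a p) < e/2"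
      using cont[unfolded continuous_at_eps_delta, rule_format, OF e2] by blast
    note d = d1 d2
    obtain d0 where d0: "d0 > 0" "ball p d0 \<subseteq> S"
      using assms(1,2) open_contains_ball by blast
    define d where "d = min d0 (min d1 d2)"
    \<comment> \<open>With this side length the parallelogram at \<open>p\<close> spanned by
      \<open>s * a\<close> and \<open>s * b\<close> stays within distance \<open>d\<close>; the
      summand \<open>1\<close> keeps the denominator positive when \<open>a\<close> and
      \<open>b\<close> vanish.\<close>
    define s where "s = d / (2 * (norm a + norm b + 1))"
    have "d > 0" using d d0 by (auto simp: d_def)
    have nn: "norm a + norm b + 1 > 0" by (simp add: add_nonneg_pos)
    have cancel: "2 * (d / (2 * N)) * N = d" if "N > 0" for N
      using that by simp
    from nn have s: "s > 0" using \<open>d > 0\<close> by (simp add: s_def)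
    have near: "dist (p + of_real x * a + of_real y * b) p < d" if "x \<in> {0..s}" "y \<in> {0..s}" for x y
    proof -
      have "norm (of_real x * a + of_real y * b) \<le> x * norm a + y * norm b"
        using that norm_triangle_ineq[of "of_real x * a" "of_real y * b"] by (simp add: norm_mult)
      also have "\<dots> \<le> s * norm a + s * norm b"
        using that by (intro add_mono mult_right_mono) auto
      also have "\<dots> < 2 * s * (norm a + norm b + 1)"
        using s by (simp add: algebra_simps add_strict_increasing add_nonneg_pos)
      also have "\<dots> = d"
        using cancel[OF nn] by (simp only: s_def)
      finally show ?thesis by (simp add: dist_norm add.assoc)
    qed
    have inS: "p + of_real x * a + of_real y * b \<in> S" if "x \<in> {0..s}" "y \<in> {0..s}" for x y
      using near[OF that] d0(2) by (auto simp: d_def dist_commute)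
    have inS': "p + of_real x * b + of_real y * a \<in> S" if "x \<in> {0..s}" "y \<in> {0..s}" for x y
      using inS[OF that(2,1)] by (simp add: algebra_simps)
    obtain x y where xy: "x \<in> {0..s}" "y \<in> {0..s}"
      "f (p + of_real s * a + of_real s * b) - f (p + of_real s * a) - f (p + of_real s * b) + f p
        = s\<^sup>2 * D a b (p + of_real x * a + of_real y * b)"
    proof (rule mixed_difference_quotient[OF s, where f=f and p=p and a=a and b=b
          and P="\<lambda>t. frechet_derivative f (at t) a" and R="D a b"])
      fix x y assume xy: "x \<in> {0..s}" "y \<in> {0..s}"
      show "((\<lambda>h. f (p + of_real h * a + of_real y * b)) has_real_derivative
          frechet_derivative f (at (p + of_real x * a + of_real y * b)) a) (at x)"
        using has_derivative_along_line[of f _ "p + of_real y * b" x a] f[OF inS[OF xy]]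
        by (simp add: algebra_simps)
      show "((\<lambda>h. frechet_derivative f (at (p + of_real x * a + of_real h * b)) a) has_real_derivative
          D a b (p + of_real x * a + of_real y * b)) (at y)"
        using has_derivative_along_line[OF P[OF inS[OF xy]]] .
    qed
    obtain x' y' where xy': "x' \<in> {0..s}" "y' \<in> {0..s}"
      "f (p + of_real s * b + of_real s * a) - f (p + of_real s * b) - f (p + of_real s * a) + f p
        = s\<^sup>2 * D b a (p + of_real x' * b + of_real y' * a)"
    proof (rule mixed_difference_quotient[OF s, where f=f and p=p and a=b and b=a
          and P="\<lambda>t. frechet_derivative f (at t) b" and R="D b a"])
      fix x y assume xy: "x \<in> {0..s}" "y \<in> {0..s}"
      show "((\<lambda>h. f (p + of_real h * b + of_real y * a)) has_real_derivative
          frechet_derivative f (at (p + of_real x * b + of_real y * a)) b) (at x)"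
        using has_derivative_along_line[of f _ "p + of_real y * a" x b] f[OF inS'[OF xy]]
        by (simp add: algebra_simps)
      show "((\<lambda>h. frechet_derivative f (at (p + of_real x * b + of_real h * a)) b) has_real_derivative
          D b a (p + of_real x * b + of_real y * a)) (at y)"
        using has_derivative_along_line[OF P[OF inS'[OF xy]]] .
    qed
    have "s\<^sup>2 * D a b (p + of_real x * a + of_real y * b) = s\<^sup>2 * D b a (p + of_real x' * b + of_real y' * a)"
      using xy(3) xy'(3) by (simp add: algebra_simps)
    then have "D a b (p + of_real x * a + of_real y * b) = D b a (p + of_real y' * a + of_real x' * b)"
      using s by (simp add: algebra_simps)
    moreover have "dist (D a b (p + of_real x * a + of_real y * b)) (D a b p) < e/2"
      using near[OF xy(1,2)] by (intro d) (simp add: d_def)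
    moreover have "dist (D b a (p + of_real y' * a + of_real x' * b)) (D b a p) < e/2"
      using near[OF xy'(2,1)] by (intro d) (simp add: d_def)
    ultimately show ?thesis unfolding dist_real_def by linarith
  qed
  then have "\<bar>D a b p - D b a p\<bar> \<le> 0"
    by (rule dense_ge)
  then show ?thesis by (simp add: D_def)
qed

text \<open>
  \<open>wirt F a b t\<close>: the Wirtinger derivatives of \<open>F\<close> at \<open>t\<close> with respect to \<open>t\<close> and its conjugate are
  \<open>a\<close> and \<open>b\<close>. For real \<open>f\<close> these are conjugate to each other, and \<open>rgrad f a t\<close> records the first.
\<close>

definition wirt :: "(complex \<Rightarrow> complex) \<Rightarrow> complex \<Rightarrow> complex \<Rightarrow> complex \<Rightarrow> bool" where
  "wirt F a b t \<longleftrightarrow> (F has_derivative (\<lambda>h. a * h + b * cnj h)) (at t)"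

definition rgrad :: "(complex \<Rightarrow> real) \<Rightarrow> complex \<Rightarrow> complex \<Rightarrow> bool" where
  "rgrad f a t \<longleftrightarrow> (f has_derivative (\<lambda>h. 2 * Re (a * h))) (at t)"

text \<open>Operator counterparts of \<open>wirt\<close>: being total functions they can be
  iterated, while \<open>wirt\<close> serves for computing with known coefficients.\<close>

definition dz :: "(complex \<Rightarrow> complex) \<Rightarrow> complex \<Rightarrow> complex" where
  "dz F t = (frechet_derivative F (at t) 1 - \<i> * frechet_derivative F (at t) \<i>) / 2"

definition dzbar :: "(complex \<Rightarrow> complex) \<Rightarrow> complex \<Rightarrow> complex" where
  "dzbar F t = (frechet_derivative F (at t) 1 + \<i> * frechet_derivative F (at t) \<i>) / 2"

lemma wirt_unique:
  assumes "wirt F a b t"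
  shows "dz F t = a" "dzbar F t = b"
proof -
  have "frechet_derivative F (at t) = (\<lambda>h. a * h + b * cnj h)"
    using frechet_derivative_at[OF assms[unfolded wirt_def]] by simp
  then show "dz F t = a" "dzbar F t = b"
    by (auto simp: dz_def dzbar_def algebra_simps)
qed

text \<open>A real-linear map of the plane is determined by its values at \<open>1\<close> and \<i>;
  solving for the coefficients of \<open>h\<close> and \<open>cnj h\<close> gives the Wirtinger
  form.\<close>

lemma linear_complex_wirt:
  fixes L :: "complex \<Rightarrow> complex"
  assumes "linear L"
  shows "L h = (L 1 - \<i> * L \<i>) / 2 * h + (L 1 + \<i> * L \<i>) / 2 * cnj h"
proof -
  have "h = Re h *\<^sub>R 1 + Im h *\<^sub>R \<i>" by (simp add: complex_eq_iff)
  then have "L h = L (Re h *\<^sub>R 1 + Im h *\<^sub>R \<i>)" by simp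
  also have "\<dots> = of_real (Re h) * L 1 + of_real (Im h) * L \<i>"
    by (simp only: linear_add[OF assms] linear_scale[OF assms]) (simp add: scaleR_conv_of_real)
  also have "\<dots> = (L 1 - \<i> * L \<i>) / 2 * h + (L 1 + \<i> * L \<i>) / 2 * cnj h"
    by (simp add: complex_eq_iff field_simps)
  finally show ?thesis .
qed

lemma wirt_smooth:
  assumes "smooth_on S F" "t \<in> S"
  shows "wirt F (dz F t) (dzbar F t) t"
proof -
  have d: "(F has_derivative frechet_derivative F (at t)) (at t)"
    using smooth_on_has_derivative[OF assms] .
  then have "frechet_derivative F (at t) = (\<lambda>h. dz F t * h + dzbar F t * cnj h)"
    unfolding dz_def dzbar_def using linear_complex_wirt[OF has_derivative_linear[OF d]] by blast
  then show ?thesis using d by (simp add: wirt_def)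
qed

lemma smooth_on_dz:
  assumes "open S" "smooth_on S F"
  shows "smooth_on S (dz F)" "smooth_on S (dzbar F)"
  unfolding dz_def[abs_def] dzbar_def[abs_def] divide_inverse
  by (intro smooth_on_mult smooth_on_diff smooth_on_add smooth_on_const smooth_on_frechet_derivative assms)+

text \<open>Bounded linear maps commute with differentiation, so the real case applies to the real
  and the imaginary part.\<close>

lemma symmetric_second_derivative_complex:
  fixes F :: "complex \<Rightarrow> complex"
  assumes "open S" "p \<in> S" "smooth_on S F"
  shows "frechet_derivative (\<lambda>t. frechet_derivative F (at t) a) (at p) b
    = frechet_derivative (\<lambda>t. frechet_derivative F (at t) b) (at p) a"
proof -
  have *: "L (frechet_derivative (\<lambda>t. frechet_derivative F (at t) a) (at p) b)
    = frechet_derivative (\<lambda>t. frechet_derivative (\<lambda>t. L (F t)) (at t) a) (at p) b"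
    if L: "bounded_linear L" for L :: "complex \<Rightarrow> real" and a b
  proof -
    have 1: "frechet_derivative (\<lambda>t. L (G t)) (at t) v = L (frechet_derivative G (at t) v)"
      if "smooth_on S G" "t \<in> S" for G t v
      using fun_cong[OF frechet_derivative_at[OF bounded_linear.has_derivative[OF L smooth_on_has_derivative[OF that]]], of v]
      by simp
    let ?G = "\<lambda>t. frechet_derivative F (at t) a"
    have "smooth_on S (\<lambda>t. L (?G t))"
      by (intro smooth_on_bounded_linear[OF assms(1) L] smooth_on_frechet_derivative assms)
    note d = smooth_on_has_derivative[OF this assms(2)]
    have "frechet_derivative (\<lambda>t. frechet_derivative (\<lambda>t. L (F t)) (at t) a) (at p)
        = frechet_derivative (\<lambda>t. L (?G t)) (at p)"
      by (rule frechet_derivative_transform_open(2)[OF assms(1,2) differentiableI[OF d]])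
        (simp add: 1[OF assms(3)])
    then show ?thesis
      using 1[OF smooth_on_frechet_derivative[OF assms(3)] assms(2)] by simp
  qed
  have "L (frechet_derivative (\<lambda>t. frechet_derivative F (at t) a) (at p) b)
      = L (frechet_derivative (\<lambda>t. frechet_derivative F (at t) b) (at p) a)"
    if L: "bounded_linear L" for L :: "complex \<Rightarrow> real"
    unfolding *[OF L]
    by (rule symmetric_second_derivative[OF assms(1,2) smooth_on_bounded_linear[OF assms(1) L assms(3)]])
  from this[OF bounded_linear_Re] this[OF bounded_linear_Im] show ?thesis
    by (simp add: complex_eq_iff)
qed

text \<open>The mixed terms cancel by symmetry, and each side is a quarter of the sum of the pure
  second derivatives in directions \<open>1\<close> and \<i>.\<close>

lemma dz_dzbar_commute:
  assumes "open S" "p \<in> S" "smooth_on S F"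
  shows "dz (dzbar F) p = dzbar (dz F) p"
proof -
  let ?u = "\<lambda>t. frechet_derivative F (at t) 1" and ?v = "\<lambda>t. frechet_derivative F (at t) \<i>"
  have u: "(?u has_derivative frechet_derivative ?u (at p)) (at p)"
    and v: "(?v has_derivative frechet_derivative ?v (at p)) (at p)"
    using smooth_on_has_derivative[OF smooth_on_frechet_derivative[OF assms(3)] assms(2)] by blast+
  have 1: "frechet_derivative (dz F) (at p) h
      = (frechet_derivative ?u (at p) h - \<i> * frechet_derivative ?v (at p) h) / 2" for h
  proof -
    have "(dz F has_derivative (\<lambda>h. (frechet_derivative ?u (at p) h - \<i> * frechet_derivative ?v (at p) h) / 2)) (at p)"
      unfolding dz_def[abs_def] by (rule derivative_eq_intros u v refl | simp)+
    from fun_cong[OF frechet_derivative_at[OF this], of h] show ?thesis by simp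
  qed
  have 2: "frechet_derivative (dzbar F) (at p) h
      = (frechet_derivative ?u (at p) h + \<i> * frechet_derivative ?v (at p) h) / 2" for h
  proof -
    have "(dzbar F has_derivative (\<lambda>h. (frechet_derivative ?u (at p) h + \<i> * frechet_derivative ?v (at p) h) / 2)) (at p)"
      unfolding dzbar_def[abs_def] by (rule derivative_eq_intros u v refl | simp)+
    from fun_cong[OF frechet_derivative_at[OF this], of h] show ?thesis by simp
  qed
  show ?thesis
    unfolding dz_def[of "dzbar F"] dzbar_def[of "dz F"] 1 2
    using symmetric_second_derivative_complex[OF assms, of 1 \<i>]
    by (simp add: complex_eq_iff field_simps)
qed

section \<open>Calculus of Wirtinger derivatives\<close>

named_theorems wirt_intros

text \<open>Separates computation from comparison: the rules in \<open>wirt_intros\<close> produce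
  the coefficients, and the two equations left over are plain algebra.\<close>

lemma wirt_eq_rhs: "wirt F a b t \<Longrightarrow> a = a' \<Longrightarrow> b = b' \<Longrightarrow> wirt F a' b' t"
  by simp

lemma wirt_transform_open:
  assumes "open S" "t \<in> S" "wirt F a b t" "\<And>s. s \<in> S \<Longrightarrow> F s = G s"
  shows "wirt G a b t"
  using assms has_derivative_transform_within_open[of F _ t UNIV S G] by (auto simp: wirt_def)

lemma wirt_const [wirt_intros]: "wirt (\<lambda>t. c) 0 0 t"
  by (simp add: wirt_def)

lemma wirt_add [wirt_intros]:
  "wirt F a b t \<Longrightarrow> wirt G c d t \<Longrightarrow> wirt (\<lambda>t. F t + G t) (a + c) (b + d) t"
  unfolding wirt_def
  by (drule (1) has_derivative_add, erule has_derivative_eq_rhs) (auto simp: algebra_simps)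

lemma wirt_diff [wirt_intros]:
  "wirt F a b t \<Longrightarrow> wirt G c d t \<Longrightarrow> wirt (\<lambda>t. F t - G t) (a - c) (b - d) t"
  unfolding wirt_def
  by (drule (1) has_derivative_diff, erule has_derivative_eq_rhs) (auto simp: algebra_simps)

lemma wirt_uminus [wirt_intros]:
  "wirt F a b t \<Longrightarrow> wirt (\<lambda>t. - F t) (- a) (- b) t"
  unfolding wirt_def
  by (drule has_derivative_minus, erule has_derivative_eq_rhs) (auto simp: algebra_simps)

lemma wirt_mult [wirt_intros]:
  "wirt F a b t \<Longrightarrow> wirt G c d t \<Longrightarrow>
    wirt (\<lambda>t. F t * G t) (a * G t + F t * c) (b * G t + F t * d) t"
  unfolding wirt_def
  by (drule (1) has_derivative_mult, erule has_derivative_eq_rhs) (auto simp: algebra_simps)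

lemma wirt_cnj [wirt_intros]:
  "wirt F a b t \<Longrightarrow> wirt (\<lambda>t. cnj (F t)) (cnj b) (cnj a) t"
  unfolding wirt_def
  by (drule bounded_linear.has_derivative[OF bounded_linear_cnj], erule has_derivative_eq_rhs)
    (auto simp: algebra_simps)

lemma wirt_inverse [wirt_intros]:
  assumes "wirt F a b t" "F t \<noteq> 0"
  shows "wirt (\<lambda>t. inverse (F t)) (- a / (F t)\<^sup>2) (- b / (F t)\<^sup>2) t"
proof -
  have "((\<lambda>t. inverse (F t)) has_derivative
      (\<lambda>h. - (inverse (F t) * (a * h + b * cnj h) * inverse (F t)))) (at t)"
    using Deriv.has_derivative_inverse[OF assms(2) assms(1)[unfolded wirt_def]] .
  also have "(\<lambda>h. - (inverse (F t) * (a * h + b * cnj h) * inverse (F t)))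
      = (\<lambda>h. - a / (F t)\<^sup>2 * h + - b / (F t)\<^sup>2 * cnj h)"
    using assms(2) by (auto simp: fun_eq_iff field_simps power2_eq_square)
  finally show ?thesis unfolding wirt_def .
qed

text \<open>The Cauchy-Riemann criterion: a vanishing conjugate coefficient is what turns data
  extracted from real smooth functions into holomorphic ones.\<close>

lemma wirt_holomorphic:
  "(F has_field_derivative a) (at t) \<longleftrightarrow> wirt F a 0 t"
  by (simp add: wirt_def has_field_derivative_def)

lemma wirt_holomorphic_on:
  "F holomorphic_on S \<Longrightarrow> open S \<Longrightarrow> t \<in> S \<Longrightarrow> wirt F (deriv F t) 0 t"
  by (simp add: wirt_holomorphic[symmetric] holomorphic_derivI)

lemma rgrad_imp_wirt: "rgrad f a t \<Longrightarrow> wirt (\<lambda>t. of_real (f t)) a (cnj a) t"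
  unfolding rgrad_def wirt_def
  by (drule bounded_linear.has_derivative[OF bounded_linear_of_real], erule has_derivative_eq_rhs)
    (auto simp: complex_eq_iff)

lemma wirt_imp_rgrad: "wirt F a (cnj a) t \<Longrightarrow> rgrad (\<lambda>t. Re (F t)) a t"
  unfolding rgrad_def wirt_def
  by (drule bounded_linear.has_derivative[OF bounded_linear_Re], erule has_derivative_eq_rhs)
    (auto simp: field_simps)

lemma rgrad_transform_open:
  assumes "open S" "t \<in> S" "rgrad f a t" "\<And>s. s \<in> S \<Longrightarrow> f s = g s"
  shows "rgrad g a t"
  using assms has_derivative_transform_within_open[of f _ t UNIV S g] by (auto simp: rgrad_def)

lemma rgrad_linear_comb:
  assumes "rgrad f a t" "rgrad g b t"
  shows "rgrad (\<lambda>t. \<alpha> * f t + \<beta> * g t) (of_real \<alpha> * a + of_real \<beta> * b) t"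
  using has_derivative_add[OF has_derivative_mult_right[OF assms(1)[unfolded rgrad_def], of \<alpha>]
      has_derivative_mult_right[OF assms(2)[unfolded rgrad_def], of \<beta>]]
  unfolding rgrad_def by (rule has_derivative_eq_rhs) (auto simp: algebra_simps)

lemma rgrad_chain:
  assumes "rgrad f a t" "(g has_real_derivative d) (at (f t))"
  shows "rgrad (\<lambda>t. g (f t)) (of_real d * a) t"
proof -
  have "((\<lambda>t. g (f t)) has_derivative (\<lambda>h. d * (2 * Re (a * h)))) (at t)"
    using has_derivative_compose[of f _ t UNIV g "(*) d"] assms
    by (simp add: rgrad_def has_field_derivative_def)
  then show ?thesis by (simp add: rgrad_def algebra_simps)
qed

lemma smooth_on_of_real:
  "open S \<Longrightarrow> smooth_on S f \<Longrightarrow> smooth_on S (\<lambda>t. complex_of_real (f t))"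
  by (rule smooth_on_bounded_linear[OF _ bounded_linear_of_real])

lemma rgrad_smooth:
  assumes "smooth_on S f" "t \<in> S"
  shows "rgrad f (dz (\<lambda>s. of_real (f s)) t) t"
proof -
  define L where "L = frechet_derivative f (at t)"
  have f: "(f has_derivative L) (at t)"
    unfolding L_def using smooth_on_has_derivative[OF assms] .
  have "((\<lambda>s. complex_of_real (f s)) has_derivative (\<lambda>h. of_real (L h))) (at t)"
    using bounded_linear.has_derivative[OF bounded_linear_of_real f] .
  from frechet_derivative_at[OF this]
  have 1: "dz (\<lambda>s. of_real (f s)) t = (of_real (L 1) - \<i> * of_real (L \<i>)) / 2"
    by (simp add: dz_def fun_eq_iff)
  have "L h = 2 * Re (dz (\<lambda>s. of_real (f s)) t * h)" for h
  proof -
    have "L h = L (Re h *\<^sub>R 1 + Im h *\<^sub>R \<i>)"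
      by (rule arg_cong[where f=L]) (simp add: complex_eq_iff)
    also have "\<dots> = Re h * L 1 + Im h * L \<i>"
      using has_derivative_linear[OF f] by (simp only: linear_add linear_scale real_scaleR_def)
    also have "\<dots> = 2 * Re (dz (\<lambda>s. of_real (f s)) t * h)"
      unfolding 1 by (simp add: field_simps)
    finally show ?thesis .
  qed
  then have "L = (\<lambda>h. 2 * Re (dz (\<lambda>s. of_real (f s)) t * h))" ..
  with f show ?thesis by (simp only: rgrad_def)
qed

section \<open>The Laplacian in terms of Wirtinger derivatives\<close>

lemma partial_eq:
  assumes "(f has_derivative f') (at t)"
  shows "partial_u f t = f' 1" "partial_v f t = f' \<i>"
proof -
  have "((\<lambda>h. f (\<i> * of_real (Im t) + of_real h * 1)) has_real_derivative f' 1) (at (Re t))"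
    by (rule has_derivative_along_line) (use assms in \<open>simp add: complex_eq[symmetric] add.commute\<close>)
  then show "partial_u f t = f' 1"
    unfolding partial_u_def by (intro DERIV_imp_deriv) (simp add: Complex_eq add.commute)
  have "((\<lambda>h. f (of_real (Re t) + of_real h * \<i>)) has_real_derivative f' \<i>) (at (Im t))"
    by (rule has_derivative_along_line) (use assms in \<open>simp add: complex_eq[symmetric] mult.commute\<close>)
  then show "partial_v f t = f' \<i>"
    unfolding partial_v_def by (intro DERIV_imp_deriv) (simp add: Complex_eq mult.commute)
qed

text \<open>The first partial derivatives are \<open>2 * Re (A s)\<close> and
  \<open>- 2 * Im (A s)\<close>. Differentiating again gives \<open>2 * Re (a + b)\<close> and
  \<open>- 2 * Re (a - b)\<close>, so \<open>a\<close> cancels in the sum.\<close>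

lemma laplacian_wirt:
  assumes "open S" "t \<in> S" "\<And>s. s \<in> S \<Longrightarrow> rgrad f (A s) s" "wirt A a b t"
  shows "laplacian f t = 4 * Re b"
proof -
  have 1: "partial_u f s = 2 * Re (A s)" "partial_v f s = - 2 * Im (A s)" if "s \<in> S" for s
    using partial_eq[OF assms(3)[OF that, unfolded rgrad_def]] by auto
  have "((\<lambda>s. 2 * Re (A s)) has_derivative (\<lambda>h. 2 * Re (a * h + b * cnj h))) (at t)"
    by (intro has_derivative_mult_right bounded_linear.has_derivative[OF bounded_linear_Re] assms(4)[unfolded wirt_def])
  then have "(partial_u f has_derivative (\<lambda>h. 2 * Re (a * h + b * cnj h))) (at t)"
    by (rule has_derivative_transform_within_open[OF _ assms(1,2)]) (simp add: 1)
  note u = partial_eq(1)[OF this]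
  have "((\<lambda>s. - 2 * Im (A s)) has_derivative (\<lambda>h. - 2 * Im (a * h + b * cnj h))) (at t)"
    by (intro has_derivative_mult_right bounded_linear.has_derivative[OF bounded_linear_Im] assms(4)[unfolded wirt_def])
  then have "(partial_v f has_derivative (\<lambda>h. - 2 * Im (a * h + b * cnj h))) (at t)"
    by (rule has_derivative_transform_within_open[OF _ assms(1,2)]) (simp add: 1)
  note v = partial_eq(2)[OF this]
  show ?thesis unfolding laplacian_def u v by simp
qed

lemma laplacian_smooth:
  assumes "open S" "t \<in> S" "smooth_on S f"
  shows "laplacian f t = 4 * Re (dzbar (dz (\<lambda>s. of_real (f s))) t)"
  by (rule laplacian_wirt[OF assms(1,2) rgrad_smooth[OF assms(3)]
        wirt_smooth[OF smooth_on_dz(1)[OF assms(1) smooth_on_of_real[OF assms(1,3)]] assms(2)]])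

text \<open>Allows the logarithmic expressions of the system to be replaced by linear combinations
  that agree with them only on the domain.\<close>

lemma laplacian_cong:
  assumes "open S" "t \<in> S" "smooth_on S f" "\<And>s. s \<in> S \<Longrightarrow> f s = g s"
  shows "laplacian g t = laplacian f t"
proof -
  have "laplacian g t = 4 * Re (dzbar (dz (\<lambda>s. of_real (f s))) t)"
    by (rule laplacian_wirt[OF assms(1,2) rgrad_transform_open[OF assms(1) _ rgrad_smooth[OF assms(3)] assms(4)]
        wirt_smooth[OF smooth_on_dz(1)[OF assms(1) smooth_on_of_real[OF assms(1,3)]] assms(2)]])
  then show ?thesis using laplacian_smooth[OF assms(1-3)] by simp
qed

lemma laplacian_linear_comb:
  assumes "open S" "t \<in> S" "smooth_on S f" "smooth_on S g"
  shows "laplacian (\<lambda>s. \<alpha> * f s + \<beta> * g s) t = \<alpha> * laplacian f t + \<beta> * laplacian g t"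
proof -
  let ?A = "dz (\<lambda>s. of_real (f s))" and ?B = "dz (\<lambda>s. of_real (g s))"
  have W: "wirt ?A (dz ?A t) (dzbar ?A t) t" "wirt ?B (dz ?B t) (dzbar ?B t) t"
    using assms by (auto intro!: wirt_smooth smooth_on_dz smooth_on_of_real)
  have "rgrad (\<lambda>s. \<alpha> * f s + \<beta> * g s) (of_real \<alpha> * ?A s + of_real \<beta> * ?B s) s" if "s \<in> S" for s
    by (rule rgrad_linear_comb[OF rgrad_smooth[OF assms(3) that] rgrad_smooth[OF assms(4) that]])
  from laplacian_wirt[OF assms(1,2) this wirt_add[OF wirt_mult[OF wirt_const W(1)] wirt_mult[OF wirt_const W(2)]]]
  have "laplacian (\<lambda>s. \<alpha> * f s + \<beta> * g s) t = 4 * Re (of_real \<alpha> * dzbar ?A t + of_real \<beta> * dzbar ?B t)"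
    by simp
  then show ?thesis
    using laplacian_smooth[OF assms(1,2,3)] laplacian_smooth[OF assms(1,2,4)] by simp
qed

section \<open>Holomorphic linear differential equations\<close>

text \<open>The Taylor coefficients of a solution of \<open>f'' = Q * f\<close> with value
  \<open>a\<close> and derivative \<open>b\<close> at the centre, where \<open>q\<close> lists the
  coefficients of \<open>Q\<close>; the recursion compares coefficients of order
  \<open>n\<close>.\<close>

fun ode_coeff :: "(nat \<Rightarrow> complex) \<Rightarrow> complex \<Rightarrow> complex \<Rightarrow> nat \<Rightarrow> complex" where
  "ode_coeff q a b 0 = a"
| "ode_coeff q a b (Suc 0) = b"
| "ode_coeff q a b (Suc (Suc n)) =
     (\<Sum>k\<in>{0..n}. q k * ode_coeff q a b (n - k)) / of_nat ((n + 1) * (n + 2))"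

text \<open>Majorant estimate: the convolution has \<open>m + 1\<close> terms, which the denominator
  \<open>(m + 1) * (m + 2)\<close> compensates, and \<open>\<rho>\<^sup>2 * M \<le> 1\<close>
  absorbs the two additional powers of \<rho>. The maximum covers the two starting
  coefficients.\<close>

lemma norm_ode_coeff_le:
  assumes "\<rho> > 0" "\<And>k. norm (q k) * \<rho> ^ k \<le> M" "\<rho>\<^sup>2 * M \<le> 1"
  shows "norm (ode_coeff q a b n) * \<rho> ^ n \<le> max (norm a) (norm b * \<rho>)"
proof (induction n rule: less_induct)
  case (less n)
  define B where "B = max (norm a) (norm b * \<rho>)"
  have B: "B \<ge> 0" by (simp add: B_def le_max_iff_disj)
  have M: "M \<ge> 0" using assms(2)[of 0] order_trans[OF norm_ge_zero, of "q 0"] by simp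
  consider "n = 0" | "n = Suc 0" | m where "n = Suc (Suc m)"
    by (cases n; cases "n - 1") auto
  then show ?case
  proof cases
    case 3
    let ?c = "ode_coeff q a b"
    have "norm (\<Sum>k\<in>{0..m}. q k * ?c (m - k)) * \<rho> ^ m \<le> (\<Sum>k\<in>{0..m}. norm (q k * ?c (m - k))) * \<rho> ^ m"
      using assms(1) by (intro mult_right_mono norm_sum) auto
    also have "\<dots> = (\<Sum>k\<in>{0..m}. (norm (q k) * \<rho> ^ k) * (norm (?c (m - k)) * \<rho> ^ (m - k)))"
      unfolding sum_distrib_right
      by (rule sum.cong) (auto simp: norm_mult power_add[symmetric] algebra_simps)
    also have "\<dots> \<le> (\<Sum>k\<in>{0..m}. M * B)"
      using assms M less.IH 3 unfolding B_def by (intro sum_mono mult_mono) auto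
    also have "\<dots> = (m + 1) * (M * B)" by simp
    finally have "norm (\<Sum>k\<in>{0..m}. q k * ?c (m - k)) * \<rho> ^ m * \<rho>\<^sup>2 \<le> (m + 1) * (M * B) * \<rho>\<^sup>2"
      by (rule mult_right_mono) auto
    also have "\<dots> = (m + 1) * B * (\<rho>\<^sup>2 * M)" by simp
    also have "\<dots> \<le> (m + 1) * B * 1"
      using assms(3) B by (intro mult_left_mono) auto
    also have "\<dots> \<le> B * ((m + 1) * (m + 2))"
      using B mult_left_mono[of 1 "real m + 2" "(m + 1) * B"] by (simp add: algebra_simps)
    finally have *: "norm (\<Sum>k\<in>{0..m}. q k * ?c (m - k)) * \<rho> ^ m * \<rho>\<^sup>2 \<le> B * ((m + 1) * (m + 2))" .
    have "norm (?c n) * \<rho> ^ n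
        = norm (\<Sum>k\<in>{0..m}. q k * ?c (m - k)) * \<rho> ^ m * \<rho>\<^sup>2 / real ((m + 1) * (m + 2))"
      unfolding 3 ode_coeff.simps norm_divide norm_of_nat by (simp only: power_Suc power2_eq_square divide_inverse mult_ac)
    also have "\<dots> \<le> B"
      using * by (subst pos_divide_le_eq) (simp_all del: of_nat_mult of_nat_add)
    finally show ?thesis by (simp only: B_def)
  qed (auto simp: B_def)
qed

lemma summable_ode_coeff:
  assumes "0 < r" "r < \<rho>" "\<And>k. norm (q k) * \<rho> ^ k \<le> M" "\<rho>\<^sup>2 * M \<le> 1"
  shows "summable (\<lambda>n. ode_coeff q a b n * of_real r ^ n)"
proof (rule summable_comparison_test)
  let ?B = "max (norm a) (norm b * \<rho>)"
  show "\<exists>N. \<forall>n\<ge>N. norm (ode_coeff q a b n * of_real r ^ n) \<le> ?B * (r / \<rho>) ^ n"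
  proof (intro exI allI impI)
    fix n :: nat
    have "norm (ode_coeff q a b n * of_real r ^ n) = (norm (ode_coeff q a b n) * \<rho> ^ n) * (r / \<rho>) ^ n"
      using assms(1,2) by (simp add: norm_mult norm_power power_divide)
    also have "\<dots> \<le> ?B * (r / \<rho>) ^ n"
      using norm_ode_coeff_le[OF _ assms(3,4), of a b n] assms(1,2) by (intro mult_right_mono) auto
    finally show "norm (ode_coeff q a b n * of_real r ^ n) \<le> ?B * (r / \<rho>) ^ n" .
  qed
  show "summable (\<lambda>n. ?B * (r / \<rho>) ^ n)"
    using assms(1,2) by (intro summable_mult summable_geometric) auto
qed

text \<open>The radius is fixed before the initial values, because two different solutions are
  needed on one disc.\<close>

lemma holomorphic_second_order_ode:
  assumes "Q holomorphic_on ball p r" "r > 0"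
  obtains \<rho> where "\<rho> > 0" "\<rho> \<le> r"
    "\<And>a b. \<exists>f. f holomorphic_on ball p \<rho> \<and> f p = a \<and> deriv f p = b \<and>
      (\<forall>t\<in>ball p \<rho>. deriv (deriv f) t = Q t * f t)"
proof -
  define q where "q n = (deriv ^^ n) Q p / fact n" for n
  have sums: "(\<lambda>n. q n * (t - p) ^ n) sums Q t" if "t \<in> ball p r" for t
    unfolding q_def using holomorphic_power_series[OF assms(1) that] .
  have "p + of_real (r / 2) \<in> ball p r" using assms(2) by (simp add: dist_norm)
  from sums_summable[OF sums[OF this]]
  have "summable (\<lambda>n. q n * of_real (r / 2) ^ n)" by simp
  from summable_imp_Bseq[OF this] obtain M where M: "M > 0" "\<And>n. norm (q n * of_real (r / 2) ^ n) \<le> M"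
    unfolding Bseq_def by blast
  \<comment> \<open>The bound \<open>r / 2\<close> preserves the estimate by \<open>M\<close> of the
    terms of the series for \<open>Q\<close>; the bound \<open>1 / (M + 1)\<close> gives
    \<open>\<rho>\<^sup>2 * M \<le> 1\<close>.\<close>
  define \<rho> where "\<rho> = min (r / 2) (1 / (M + 1))"
  have \<rho>: "\<rho> > 0" "\<rho> \<le> r / 2" "\<rho> \<le> 1 / (M + 1)" using assms(2) M(1) by (auto simp: \<rho>_def)
  have q: "norm (q k) * \<rho> ^ k \<le> M" for k
  proof -
    have "norm (q k) * \<rho> ^ k \<le> norm (q k) * (r / 2) ^ k"
      using \<rho> by (intro mult_left_mono power_mono) auto
    also have "\<dots> \<le> M" using M(2)[of k] assms(2) by (simp add: norm_mult norm_power)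
    finally show ?thesis .
  qed
  have "\<rho>\<^sup>2 * M \<le> (1 / (M + 1))\<^sup>2 * M"
    using \<rho> M(1) by (intro mult_right_mono power_mono) auto
  also have "\<dots> \<le> 1"
  proof -
    have "M * 1 \<le> (M + 1) * (M + 1)" using M(1) by (intro mult_mono) auto
    then show ?thesis using M(1) by (simp add: power_divide power2_eq_square divide_le_eq)
  qed
  finally have \<rho>M: "\<rho>\<^sup>2 * M \<le> 1" .
  have ex: "\<exists>f. f holomorphic_on ball p \<rho> \<and> f p = a \<and> deriv f p = b \<and>
      (\<forall>t\<in>ball p \<rho>. deriv (deriv f) t = Q t * f t)" for a b
  proof -
    define C where "C = Abs_fps (ode_coeff q a b)"
    have radC: "fps_conv_radius C \<ge> \<rho>"
      unfolding C_def fps_conv_radius_def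
    proof (rule conv_radius_geI_ex')
      fix s :: real assume "0 < s" "ereal s < ereal \<rho>"
      then show "summable (\<lambda>n. fps_nth (Abs_fps (ode_coeff q a b)) n * of_real s ^ n)"
        using summable_ode_coeff[OF _ _ q \<rho>M] by simp
    qed
    have radq: "fps_conv_radius (Abs_fps q) \<ge> \<rho>"
      unfolding fps_conv_radius_def
    proof (rule conv_radius_geI_ex')
      fix s :: real assume s: "0 < s" "ereal s < ereal \<rho>"
      then have "p + of_real s \<in> ball p r" using \<rho>(2) assms(2) by (simp add: dist_norm)
      from sums_summable[OF sums[OF this]] show "summable (\<lambda>n. fps_nth (Abs_fps q) n * of_real s ^ n)" by simp
    qed
    have rad1: "fps_conv_radius (fps_deriv C) \<ge> \<rho>"
      using order_trans[OF radC fps_conv_radius_deriv] .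
    \<comment> \<open>The recursion for the coefficients is exactly this identity of formal power
      series; evaluation inside the disc of convergence turns it into the differential
      equation.\<close>
    have ode: "fps_deriv (fps_deriv C) = Abs_fps q * C"
    proof (rule fps_ext)
      fix n
      have cancel: "c * (d * (x / (c * d))) = x" if "c \<noteq> 0" "d \<noteq> 0" for c d x :: complex
        using that by simp
      have "fps_nth (fps_deriv (fps_deriv C)) n
          = of_nat (n + 1) * (of_nat (n + 2) * ode_coeff q a b (Suc (Suc n)))"
        by (simp add: C_def)
      also have "\<dots> = (\<Sum>k\<in>{0..n}. q k * ode_coeff q a b (n - k))"
        unfolding ode_coeff.simps of_nat_mult by (rule cancel) (unfold of_nat_eq_0_iff, simp_all)
      also have "\<dots> = fps_nth (Abs_fps q * C) n"
        by (simp add: C_def fps_mult_nth)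
      finally show "fps_nth (fps_deriv (fps_deriv C)) n = fps_nth (Abs_fps q * C) n" .
    qed
    define f where "f t = eval_fps C (t - p)" for t
    have inball: "ereal (norm (t - p)) < \<rho>" if "t \<in> ball p \<rho>" for t
      using that by (simp add: dist_norm norm_minus_commute)
    have d: "((\<lambda>t. eval_fps F (t - p)) has_field_derivative eval_fps (fps_deriv F) (t - p)) (at t)"
      if "fps_conv_radius F \<ge> \<rho>" "t \<in> ball p \<rho>" for F t
    proof -
      have "(eval_fps F has_field_derivative eval_fps (fps_deriv F) (t - p)) (at (t - p))"
        by (rule has_field_derivative_eval_fps) (rule less_le_trans[OF inball[OF that(2)] that(1)])
      moreover have "((\<lambda>t. t - p) has_field_derivative 1) (at t)"
        using DERIV_diff[OF DERIV_ident DERIV_const, of p t] by simp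
      ultimately show ?thesis
        using DERIV_chain2[of "eval_fps F" _ "\<lambda>t. t - p" t 1] by simp
    qed
    have df: "deriv f t = eval_fps (fps_deriv C) (t - p)" if "t \<in> ball p \<rho>" for t
      unfolding f_def[abs_def] using DERIV_imp_deriv[OF d[OF radC that]] .
    have ddf: "deriv (deriv f) t = Q t * f t" if t: "t \<in> ball p \<rho>" for t
    proof -
      have "(deriv f has_field_derivative eval_fps (fps_deriv (fps_deriv C)) (t - p)) (at t)"
        by (rule has_field_derivative_transform_within_open[OF d[OF rad1 t] open_ball t]) (simp add: df)
      then have "deriv (deriv f) t = eval_fps (Abs_fps q * C) (t - p)"
        unfolding ode by (rule DERIV_imp_deriv)
      also have "\<dots> = eval_fps (Abs_fps q) (t - p) * f t"
        unfolding f_def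
        by (rule eval_fps_mult[OF less_le_trans[OF inball[OF t] radq] less_le_trans[OF inball[OF t] radC]])
      also have "eval_fps (Abs_fps q) (t - p) = Q t"
        unfolding eval_fps_def using sums_unique[OF sums, of t] t \<rho>(2) assms(2) by simp
      finally show ?thesis .
    qed
    have "f holomorphic_on ball p \<rho>"
      unfolding f_def[abs_def] holomorphic_on_open[OF open_ball] by (intro ballI exI) (rule d[OF radC])
    moreover have "f p = a" "deriv f p = b"
      using \<rho>(1) df[of p] by (auto simp: f_def eval_fps_at_0 C_def)
    ultimately show ?thesis using ddf by blast
  qed
  show ?thesis
    by (rule that[OF \<rho>(1) _ ex]) (use \<rho>(2) assms(2) in auto)
qed

section \<open>The Liouville equation\<close>

lemma wirt_zero_imp_constant:
  assumes "convex S" "\<And>t. t \<in> S \<Longrightarrow> wirt F 0 0 t" "s \<in> S" "t \<in> S"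
  shows "F s = F t"
  by (rule has_derivative_zero_unique[OF assms(1) _ assms(3,4)])
    (use assms(2) in \<open>auto simp: wirt_def intro: has_derivative_at_withinI\<close>)

text \<open>Cramer's rule with determinant 1; it strips the test solutions from the vanishing
  Wronskians.\<close>

lemma linear_pair_zero:
  fixes x y :: complex
  assumes "a * d - b * c = 1" "x * a + y * b = 0" "x * c + y * d = 0"
  shows "x = 0"
proof -
  have "x = x * (a * d - b * c)" using assms(1) by simp
  also have "\<dots> = d * (x * a + y * b) - b * (x * c + y * d)" by (simp add: algebra_simps)
  also have "\<dots> = 0" using assms(2,3) by simp
  finally show ?thesis .
qed

text \<open>
  Taking Wronskians of \<open>u\<close> with a solution \<open>f\<close> in the variable \<open>t\<close>, and with the conjugate of a
  solution \<open>h\<close> in the conjugate variable, gives a constant; it vanishes at \<open>p\<close>. Letting \<open>f\<close> and \<open>h\<close>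
  run through \<open>f1, f2\<close>, this recovers \<open>u = 0\<close>.
\<close>

lemma wirt_ode_unique:
  assumes S: "convex S" "p \<in> S" "t \<in> S"
    and f1: "\<And>t. t \<in> S \<Longrightarrow> wirt f1 (f1' t) 0 t" "\<And>t. t \<in> S \<Longrightarrow> wirt f1' (q t * f1 t) 0 t"
    and f2: "\<And>t. t \<in> S \<Longrightarrow> wirt f2 (f2' t) 0 t" "\<And>t. t \<in> S \<Longrightarrow> wirt f2' (q t * f2 t) 0 t"
    and W: "\<And>t. t \<in> S \<Longrightarrow> f1 t * f2' t - f1' t * f2 t = 1"
    and u: "\<And>t. t \<in> S \<Longrightarrow> wirt u (u1 t) (v1 t) t"
      "\<And>t. t \<in> S \<Longrightarrow> wirt u1 (q t * u t) (u2 t) t"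
      "\<And>t. t \<in> S \<Longrightarrow> wirt v1 (u2 t) (cnj (q t) * u t) t"
      "\<And>t. t \<in> S \<Longrightarrow> wirt u2 (q t * v1 t) (cnj (q t) * u1 t) t"
    and p: "u p = 0" "u1 p = 0" "v1 p = 0" "u2 p = 0"
  shows "u t = 0"
proof -
  \<comment> \<open>Here \<open>u1\<close>, \<open>v1\<close> and \<open>u2\<close> act as the
    derivatives of \<open>u\<close> in \<open>t\<close>, in the conjugate variable, and in both.
    Differentiating, the terms with these functions cancel in pairs and so do those with
    \<open>q\<close>.\<close>
  have dbl: "u t * f' t * cnj (h' t) - u1 t * f t * cnj (h' t) - v1 t * f' t * cnj (h t) + u2 t * f t * cnj (h t) = 0"
    if f: "\<And>t. t \<in> S \<Longrightarrow> wirt f (f' t) 0 t" "\<And>t. t \<in> S \<Longrightarrow> wirt f' (q t * f t) 0 t"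
      and h: "\<And>t. t \<in> S \<Longrightarrow> wirt h (h' t) 0 t" "\<And>t. t \<in> S \<Longrightarrow> wirt h' (q t * h t) 0 t"
    for f f' h h'
  proof -
    let ?C = "\<lambda>t. u t * f' t * cnj (h' t) - u1 t * f t * cnj (h' t) - v1 t * f' t * cnj (h t) + u2 t * f t * cnj (h t)"
    have "wirt ?C 0 0 s" if "s \<in> S" for s
      by (rule wirt_eq_rhs, (rule wirt_intros f[OF that] h[OF that] u[OF that])+)
        (simp_all add: algebra_simps)
    from wirt_zero_imp_constant[of S ?C, OF S(1) this S(3,2)] show ?thesis
      using p by simp
  qed
  \<comment> \<open>For fixed \<open>h\<close>, the choices \<open>f1\<close> and \<open>f2\<close>
    give two linear equations whose determinant is the Wronskian; the second unknown is
    \<open>u2 t * cnj (h t) - u1 t * cnj (h' t)\<close>.\<close>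
  have hol: "u t * cnj (h' t) + - v1 t * cnj (h t) = 0"
    if h: "\<And>t. t \<in> S \<Longrightarrow> wirt h (h' t) 0 t" "\<And>t. t \<in> S \<Longrightarrow> wirt h' (q t * h t) 0 t" for h h'
  proof (rule linear_pair_zero[where a="f2' t" and d="f1 t" and b="f2 t" and c="f1' t"
        and y="u2 t * cnj (h t) - u1 t * cnj (h' t)"])
    show "f2' t * f1 t - f2 t * f1' t = 1"
      using W[OF S(3)] by (simp add: mult.commute)
  qed (use dbl[OF f1 h] dbl[OF f2 h] in \<open>simp_all add: algebra_simps\<close>)
  show ?thesis
  proof (rule linear_pair_zero[where a="cnj (f2' t)" and d="cnj (f1 t)" and b="cnj (f2 t)" and c="cnj (f1' t)"
        and y="- v1 t"])
    show "cnj (f2' t) * cnj (f1 t) - cnj (f2 t) * cnj (f1' t) = 1"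
      using arg_cong[OF W[OF S(3)], of cnj] by (simp add: mult.commute)
  qed (use hol[OF f1] hol[OF f2] in simp_all)
qed

text \<open>The radius is one on which the linear equation is solved by power series; positivity of
  \<open>\<phi>\<close> keeps \<open>f1\<close> away from zero on that whole disc, so no further
  shrinking is needed.\<close>

lemma liouville_representation:
  fixes w :: "complex \<Rightarrow> real"
  assumes D: "open D" and sm: "smooth_on D w" and lap: "\<And>t. t \<in> D \<Longrightarrow> laplacian w t = 2 * exp (w t)"
    and "p \<in> D"
  obtains r g where "r > 0" "ball p r \<subseteq> D" "g holomorphic_on ball p r"
    "\<And>t. t \<in> ball p r \<Longrightarrow> deriv g t \<noteq> 0" "\<And>t. t \<in> ball p r \<Longrightarrow> cmod (g t) < 1"
    "\<And>t. t \<in> ball p r \<Longrightarrow> exp (w t) = 4 * (cmod (deriv g t))\<^sup>2 / (1 - (cmod (g t))\<^sup>2)\<^sup>2"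
proof -
  define A where "A = dz (\<lambda>t. of_real (w t))"
  define E where "E t = complex_of_real (exp (w t))" for t
  define S where "S t = dz A t - A t * A t / 2" for t
  define q where "q t = - S t / 2" for t
  have smA: "smooth_on D A"
    unfolding A_def by (intro smooth_on_dz smooth_on_of_real D sm)
  have w: "rgrad w (A t) t" if "t \<in> D" for t
    unfolding A_def using rgrad_smooth[OF sm that] .
  have E: "wirt E (E t * A t) (E t * cnj (A t)) t" if "t \<in> D" for t
    using rgrad_imp_wirt[OF rgrad_chain[OF w[OF that] DERIV_exp]] by (simp add: E_def[abs_def])
  have dbA: "dzbar A t = E t / 2" if t: "t \<in> D" for t
  proof -
    have "4 * Re (dzbar A t) = 2 * exp (w t)"
      using laplacian_smooth[OF D t sm] lap[OF t] by (simp add: A_def)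
    \<comment> \<open>The Laplacian only yields the real part of \<open>dzbar A t\<close>. The
      imaginary part vanishes because conjugation exchanges the two Wirtinger derivatives of a real
      function, and these commute.\<close>
    moreover have "cnj (dzbar A t) = dzbar A t"
    proof -
      have "cnj (A s) = dzbar (\<lambda>t. of_real (w t)) s" if "s \<in> D" for s
        using wirt_unique(2)[OF rgrad_imp_wirt[OF w[OF that]]] by simp
      from wirt_transform_open[OF D t wirt_cnj[OF wirt_smooth[OF smA t]] this]
      have "dz (dzbar (\<lambda>t. of_real (w t))) t = cnj (dzbar A t)"
        by (rule wirt_unique(1))
      then show ?thesis
        using dz_dzbar_commute[OF D t smooth_on_of_real[OF D sm]] by (simp add: A_def)
    qed
    ultimately show ?thesis
      by (auto simp: E_def complex_eq_iff)
  qed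
  have A: "wirt A (dz A t) (E t / 2) t" if "t \<in> D" for t
    using wirt_smooth[OF smA that] dbA[OF that] by simp
  \<comment> \<open>Exchanging the order of differentiation reduces the conjugate derivative of
    \<open>dz A\<close> to the \<open>t\<close>-derivative of the known function
    \<open>E / 2\<close>.\<close>
  have A1: "wirt (dz A) (dz (dz A) t) (E t * A t / 2) t" if t: "t \<in> D" for t
  proof -
    have "wirt (\<lambda>s. E s * (1 / 2)) (E t * A t * (1 / 2)) (E t * cnj (A t) * (1 / 2)) t"
      using wirt_mult[OF E[OF t] wirt_const] by (simp only: mult_zero_right add_0_right)
    then have "wirt (dzbar A) (E t * A t * (1 / 2)) (E t * cnj (A t) * (1 / 2)) t"
      by (rule wirt_transform_open[OF D t]) (simp add: dbA)
    then have "dzbar (dz A) t = E t * A t / 2"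
      using wirt_unique(1) dz_dzbar_commute[OF D t smA] by fastforce
    then show ?thesis
      using wirt_smooth[OF smooth_on_dz(1)[OF D smA] t] by (simp only:)
  qed
  have "wirt S (dz (dz A) t - A t * dz A t) 0 t" if t: "t \<in> D" for t
  proof -
    have "wirt (\<lambda>t. dz A t - A t * A t * (1 / 2)) (dz (dz A) t - A t * dz A t) 0 t"
      by (rule wirt_eq_rhs, (rule wirt_intros A[OF t] A1[OF t])+) (simp_all add: field_simps)
    then show ?thesis by (simp add: S_def[abs_def])
  qed
  then have "S holomorphic_on D"
    unfolding holomorphic_on_open[OF D] wirt_holomorphic by blast
  then have "q holomorphic_on D"
    unfolding q_def[abs_def] by (intro holomorphic_intros) auto
  obtain r0 where r0: "r0 > 0" "ball p r0 \<subseteq> D"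
    using D \<open>p \<in> D\<close> open_contains_ball by blast
  obtain r where r: "r > 0" "r \<le> r0" and ode: "\<And>a b. \<exists>f. f holomorphic_on ball p r \<and> f p = a \<and> deriv f p = b \<and>
      (\<forall>t\<in>ball p r. deriv (deriv f) t = q t * f t)"
    using holomorphic_second_order_ode[OF holomorphic_on_subset[OF \<open>q holomorphic_on D\<close> r0(2)] r0(1)] by blast
  define B where "B = ball p r"
  have B: "B \<subseteq> D" "open B" "convex B" "p \<in> B"
    using r r0(2) by (auto simp: B_def)
  \<comment> \<open>The function \<open>A\<close> satisfies the Riccati equation
    \<open>dz A t = S t + A t * A t / 2\<close>; this is the standard substitution that makes it
    linear, with potential \<open>q\<close>.\<close>
  define \<phi> where "\<phi> t = exp (- w t / 2)" for t
  define \<Phi> where "\<Phi> t = complex_of_real (\<phi> t)" for t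
  define \<Phi>1 where "\<Phi>1 t = - A t * \<Phi> t / 2" for t
  \<comment> \<open>The mixed derivative of \<open>\<Phi>\<close>: differentiate
    \<open>\<Phi>1\<close> in the conjugate variable and insert \<open>E / 2\<close> for that
    derivative of \<open>A\<close>.\<close>
  define \<Phi>2 where "\<Phi>2 t = (A t * cnj (A t) - E t) * \<Phi> t / 4" for t
  have \<phi>pos: "\<phi> t > 0" for t by (simp add: \<phi>_def)
  have E\<Phi>: "E t * \<Phi> t * \<Phi> t = 1" for t
    by (simp add: E_def \<Phi>_def \<phi>_def flip: of_real_mult exp_add)
  have real: "cnj (\<Phi> t) = \<Phi> t" "cnj (E t) = E t" "cnj (\<Phi>2 t) = \<Phi>2 t" for t
    by (simp_all add: \<Phi>_def E_def \<Phi>2_def mult.commute)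
  have \<Phi>: "wirt \<Phi> (\<Phi>1 t) (cnj (\<Phi>1 t)) t" if "t \<in> D" for t
  proof -
    have "((\<lambda>x. exp (- x / 2)) has_real_derivative (- \<phi> t / 2)) (at (w t))"
      by (auto intro!: derivative_eq_intros simp: \<phi>_def)
    from rgrad_imp_wirt[OF rgrad_chain[OF w[OF that] this]] show ?thesis
      by (simp add: \<Phi>_def[abs_def] \<Phi>1_def \<phi>_def mult.commute)
  qed
  have \<Phi>1: "wirt \<Phi>1 (q t * \<Phi> t) (\<Phi>2 t) t" if t: "t \<in> D" for t
  proof -
    have "wirt (\<lambda>t. - (A t * \<Phi> t) * (1 / 2)) (q t * \<Phi> t) (\<Phi>2 t) t"
      by (rule wirt_eq_rhs, (rule wirt_intros A[OF t] \<Phi>[OF t])+)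
        (simp_all add: \<Phi>1_def \<Phi>2_def q_def S_def real field_simps)
    then show ?thesis by (simp add: \<Phi>1_def[abs_def])
  qed
  have \<Phi>2: "wirt \<Phi>2 (q t * cnj (\<Phi>1 t)) (cnj (q t) * \<Phi>1 t) t" if t: "t \<in> D" for t
  proof -
    have "wirt (\<lambda>t. (A t * cnj (A t) - E t) * \<Phi> t * (1 / 4)) (q t * cnj (\<Phi>1 t)) (cnj (q t) * \<Phi>1 t) t"
      by (rule wirt_eq_rhs, (rule wirt_intros A[OF t] E[OF t] \<Phi>[OF t])+)
        (simp_all add: \<Phi>1_def q_def S_def real field_simps)
    then show ?thesis by (simp add: \<Phi>2_def[abs_def])
  qed
  text \<open>The initial values are chosen so that \<open>(|f1|\<^sup>2 - |f2|\<^sup>2) / 2\<close> matches \<open>\<Phi>\<close>, \<open>\<Phi>1\<close> and \<open>\<Phi>2\<close> at \<open>p\<close>;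
    for \<open>\<Phi>2\<close> this uses \<open>E \<Phi>\<^sup>2 = 1\<close>.\<close>
  define a where "a = complex_of_real (sqrt (2 * \<phi> p))"
  have "a * a = of_real (sqrt (2 * \<phi> p) * sqrt (2 * \<phi> p))"
    unfolding a_def by (rule of_real_mult[symmetric])
  then have a: "a * a = 2 * \<Phi> p" "a \<noteq> 0" "cnj a = a"
    using \<phi>pos[of p] by (auto simp: a_def \<Phi>_def)
  obtain f1 where f1: "f1 holomorphic_on B" "f1 p = a" "deriv f1 p = 2 * \<Phi>1 p / a"
    "\<And>t. t \<in> B \<Longrightarrow> deriv (deriv f1) t = q t * f1 t"
    using ode unfolding B_def by metis
  obtain f2 where f2: "f2 holomorphic_on B" "f2 p = 0" "deriv f2 p = 1 / a"
    "\<And>t. t \<in> B \<Longrightarrow> deriv (deriv f2) t = q t * f2 t"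
    using ode unfolding B_def by metis
  have wf1: "wirt f1 (deriv f1 t) 0 t" "wirt (deriv f1) (q t * f1 t) 0 t" if "t \<in> B" for t
    using wirt_holomorphic_on[OF f1(1) B(2) that]
      wirt_holomorphic_on[OF holomorphic_deriv[OF f1(1) B(2)] B(2) that] f1(4)[OF that] by auto
  have wf2: "wirt f2 (deriv f2 t) 0 t" "wirt (deriv f2) (q t * f2 t) 0 t" if "t \<in> B" for t
    using wirt_holomorphic_on[OF f2(1) B(2) that]
      wirt_holomorphic_on[OF holomorphic_deriv[OF f2(1) B(2)] B(2) that] f2(4)[OF that] by auto
  have W: "f1 t * deriv f2 t - deriv f1 t * f2 t = 1" if t: "t \<in> B" for t
  proof -
    let ?W = "\<lambda>t. f1 t * deriv f2 t - deriv f1 t * f2 t"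
    have "wirt ?W 0 0 s" if "s \<in> B" for s
      by (rule wirt_eq_rhs, (rule wirt_intros wf1[OF that] wf2[OF that])+) (simp_all add: algebra_simps)
    from wirt_zero_imp_constant[of B ?W, OF B(3) this t B(4)] show ?thesis
      using f1 f2 a by simp
  qed
  \<comment> \<open>The defect \<open>u\<close> together with its expected first and mixed
    derivatives; these four functions form the closed system demanded by
    \<open>wirt_ode_unique\<close>.\<close>
  define u where "u t = \<Phi> t - (f1 t * cnj (f1 t) - f2 t * cnj (f2 t)) * (1 / 2)" for t
  define u1 where "u1 t = \<Phi>1 t - (deriv f1 t * cnj (f1 t) - deriv f2 t * cnj (f2 t)) * (1 / 2)" for t
  define v1 where "v1 t = cnj (\<Phi>1 t) - (f1 t * cnj (deriv f1 t) - f2 t * cnj (deriv f2 t)) * (1 / 2)" for t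
  define u2 where "u2 t = \<Phi>2 t - (deriv f1 t * cnj (deriv f1 t) - deriv f2 t * cnj (deriv f2 t)) * (1 / 2)" for t
  have u0: "u t = 0" if "t \<in> B" for t
  proof (rule wirt_ode_unique[OF B(3,4) that wf1 wf2 W, where ?u1.0=u1 and ?v1.0=v1 and ?u2.0=u2])
    fix s assume s: "s \<in> B"
    then have "s \<in> D" using B(1) by blast
    note wi = wirt_intros \<Phi>[OF this] \<Phi>1[OF this] \<Phi>2[OF this] wf1[OF s] wf2[OF s]
    show "wirt u (u1 s) (v1 s) s" unfolding u_def[abs_def]
      by (rule wirt_eq_rhs, (rule wi)+) (simp_all add: u1_def v1_def algebra_simps)
    show "wirt u1 (q s * u s) (u2 s) s" unfolding u1_def[abs_def]
      by (rule wirt_eq_rhs, (rule wi)+) (simp_all add: u_def u2_def algebra_simps)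
    show "wirt v1 (u2 s) (cnj (q s) * u s) s" unfolding v1_def[abs_def]
      by (rule wirt_eq_rhs, (rule wi)+) (simp_all add: u_def u2_def real algebra_simps)
    show "wirt u2 (q s * v1 s) (cnj (q s) * u1 s) s" unfolding u2_def[abs_def]
      by (rule wirt_eq_rhs, (rule wi)+) (simp_all add: u1_def v1_def algebra_simps)
  next
    show "u p = 0" using a f1(2) f2(2) by (simp add: u_def)
    show "u1 p = 0" using a f1(2,3) f2(2,3) by (simp add: u1_def)
    show "v1 p = 0" using a f1(2,3) f2(2,3) by (simp add: v1_def)
    have "\<Phi>1 p * cnj (\<Phi>1 p) * 4 = A p * cnj (A p) * \<Phi> p * \<Phi> p"
      by (simp add: \<Phi>1_def real)
    then have "(4 * (\<Phi>1 p * cnj (\<Phi>1 p)) - 1) = \<Phi>2 p * 4 * \<Phi> p"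
      using E\<Phi>[of p] by (simp add: \<Phi>2_def algebra_simps)
    moreover have "\<Phi> p \<noteq> 0" using \<phi>pos[of p] by (simp add: \<Phi>_def)
    moreover have "deriv f1 p * cnj (deriv f1 p) - deriv f2 p * cnj (deriv f2 p)
        = (4 * (\<Phi>1 p * cnj (\<Phi>1 p)) - 1) / (a * a)"
    proof -
      have "2 * x / a * (2 * y / a) - 1 / a * (1 / a) = (4 * (x * y) - 1) / (a * a)" for x y
        by (simp add: diff_divide_distrib)
      then show ?thesis using a(3) by (simp add: f1(3) f2(3))
    qed
    ultimately show "u2 p = 0"
      unfolding u2_def a(1) by (simp add: field_simps)
  qed
  have rep: "2 * \<phi> t = (cmod (f1 t))\<^sup>2 - (cmod (f2 t))\<^sup>2" if "t \<in> B" for t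
  proof -
    have "complex_of_real (2 * \<phi> t) = of_real ((cmod (f1 t))\<^sup>2 - (cmod (f2 t))\<^sup>2)"
      using u0[OF that] by (simp add: u_def \<Phi>_def complex_norm_square field_simps del: of_real_power)
    then show ?thesis by (simp only: of_real_eq_iff)
  qed
  have f1nz: "f1 t \<noteq> 0" if "t \<in> B" for t
  proof
    assume "f1 t = 0"
    then have "2 * \<phi> t = - (cmod (f2 t))\<^sup>2" using rep[OF that] by simp
    then show False using \<phi>pos[of t] zero_le_power2[of "cmod (f2 t)"] by linarith
  qed
  \<comment> \<open>The Wronskian 1 makes the derivative of this quotient
    \<open>1 / (f1 t)\<^sup>2\<close>, and \<open>rep\<close> gives \<open>1 - (cmod (g t))\<^sup>2
    = 2 * \<phi> t / (cmod (f1 t))\<^sup>2\<close>; in the Liouville expression \<open>f1\<close>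
    then cancels, leaving \<open>1 / (\<phi> t)\<^sup>2\<close>.\<close>
  define g where "g t = f2 t / f1 t" for t
  have g: "g holomorphic_on B"
    unfolding g_def[abs_def] using f1(1) f2(1) f1nz by (intro holomorphic_intros) auto
  have dg: "deriv g t = 1 / (f1 t)\<^sup>2" if t: "t \<in> B" for t
  proof -
    have "(g has_field_derivative (deriv f2 t * f1 t - f2 t * deriv f1 t) / (f1 t * f1 t)) (at t)"
      unfolding g_def[abs_def] using f1nz[OF t]
      by (intro DERIV_divide holomorphic_derivI[OF f1(1) B(2) t] holomorphic_derivI[OF f2(1) B(2) t])
    then show ?thesis
      using W[OF t] DERIV_imp_deriv by (fastforce simp: power2_eq_square mult.commute)
  qed
  show ?thesis
  proof (rule that[of r g])
    show "ball p r \<subseteq> D" "r > 0" "g holomorphic_on ball p r"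
      using B(1) r g by (auto simp: B_def)
    fix t assume "t \<in> ball p r"
    then have t: "t \<in> B" by (simp add: B_def)
    show "deriv g t \<noteq> 0" using dg[OF t] f1nz[OF t] by simp
    have n: "(cmod (f1 t))\<^sup>2 > 0" using f1nz[OF t] by simp
    have gt: "1 - (cmod (g t))\<^sup>2 = 2 * \<phi> t / (cmod (f1 t))\<^sup>2"
      using n unfolding rep[OF t] g_def by (simp add: norm_divide power_divide diff_divide_distrib)
    then have "(cmod (g t))\<^sup>2 < 1\<^sup>2"
      using divide_pos_pos[OF _ n, of "2 * \<phi> t"] \<phi>pos[of t] by simp
    then show "cmod (g t) < 1"
      by (rule power_less_imp_less_base) simp
    have "exp (w t) = 1 / (\<phi> t)\<^sup>2"
      by (simp add: \<phi>_def field_simps flip: exp_double exp_add)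
    also have "\<dots> = 4 * (1 / (cmod (f1 t))\<^sup>2)\<^sup>2 / (2 * \<phi> t / (cmod (f1 t))\<^sup>2)\<^sup>2"
      using n \<phi>pos[of t] by (simp add: field_simps)
    also have "1 / (cmod (f1 t))\<^sup>2 = cmod (deriv g t)"
      unfolding dg[OF t] by (simp add: norm_divide norm_power)
    finally show "exp (w t) = 4 * (cmod (deriv g t))\<^sup>2 / (1 - (cmod (g t))\<^sup>2)\<^sup>2"
      unfolding gt .
  qed
qed

section \<open>Solutions of the Liouville equation from holomorphic functions\<close>

lemma smooth_on_ln_compose:
  fixes f :: "'a::euclidean_space \<Rightarrow> real"
  assumes "open S" "smooth_on S f" "\<And>t. t \<in> S \<Longrightarrow> f t > 0"
  shows "smooth_on S (\<lambda>t. ln (f t))"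
  by (rule smooth_on_compose_real[where f=f and g=ln, OF assms(1) open_greaterThan _ smooth_on_ln assms(2)])
    (use assms(3) in auto)

text \<open>Excluding the unit circle is enough, as the denominator is squared; the converse
  direction thus covers values inside as well as outside the disc.\<close>

lemma liouville_solution:
  assumes D: "open D" and hol: "g holomorphic_on D"
    and nz: "\<And>t. t \<in> D \<Longrightarrow> deriv g t \<noteq> 0" "\<And>t. t \<in> D \<Longrightarrow> (cmod (g t))\<^sup>2 \<noteq> 1"
  defines "w \<equiv> \<lambda>t. ln (4 * (cmod (deriv g t))\<^sup>2 / (1 - (cmod (g t))\<^sup>2)\<^sup>2)"
  shows "smooth_on D w" "t \<in> D \<Longrightarrow> laplacian w t = 2 * exp (w t)"
    "t \<in> D \<Longrightarrow> exp (w t) = 4 * (cmod (deriv g t))\<^sup>2 / (1 - (cmod (g t))\<^sup>2)\<^sup>2"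
proof -
  define N where "N t = 4 * (cmod (deriv g t))\<^sup>2" for t
  define Q where "Q t = (1 - (cmod (g t))\<^sup>2)\<^sup>2" for t
  \<comment> \<open>The Wirtinger gradient of \<open>w\<close>. The first summand stems from
    \<open>ln (N t)\<close> and is holomorphic, so only the second, from \<open>- ln (Q t)\<close>,
    contributes to the Laplacian.\<close>
  define A where "A t = deriv (deriv g) t * inverse (deriv g t)
    + 2 * (deriv g t * cnj (g t)) * inverse (1 - g t * cnj (g t))" for t
  have d1: "1 - g t * cnj (g t) \<noteq> 0" if "t \<in> D" for t
    using nz(2)[OF that] by (metis complex_norm_square eq_iff_diff_eq_0 of_real_1 of_real_eq_iff)
  have pos: "N t > 0" "Q t > 0" if "t \<in> D" for t
    using nz[OF that] by (auto simp: N_def Q_def)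
  have holg: "deriv g holomorphic_on D" "deriv (deriv g) holomorphic_on D"
    by (intro holomorphic_deriv hol D)+
  have N_eq: "N t = Re (4 * (deriv g t * cnj (deriv g t)))" for t
    by (simp add: N_def flip: complex_norm_square of_real_power)
  have Q_eq: "Q t = Re ((1 - g t * cnj (g t)) * (1 - g t * cnj (g t)))" for t
    by (simp add: Q_def power2_eq_square flip: complex_norm_square of_real_power)
  have cN: "of_real (N t) = 4 * (deriv g t * cnj (deriv g t))" for t
    unfolding N_def of_real_mult complex_norm_square by simp
  have cQ: "of_real (Q t) = (1 - g t * cnj (g t)) * (1 - g t * cnj (g t))" for t
    unfolding Q_def of_real_mult of_real_diff power2_eq_square[of "1 - _"] complex_norm_square by simp
  have w_eq: "w t = 1 * ln (N t) + (- 1) * ln (Q t)" if "t \<in> D" for t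
    using pos[OF that] by (simp add: w_def ln_div flip: N_def Q_def)
  have "smooth_on D N" "smooth_on D Q"
    unfolding N_eq[abs_def] Q_eq[abs_def]
    by (intro smooth_on_bounded_linear[OF D bounded_linear_Re] smooth_on_mult smooth_on_diff
        smooth_on_const smooth_on_bounded_linear[OF D bounded_linear_cnj] smooth_on_holomorphic D hol holg)+
  then have sm: "smooth_on D (\<lambda>t. ln (N t))" "smooth_on D (\<lambda>t. ln (Q t))"
    using smooth_on_ln_compose[OF D] pos by auto
  have "smooth_on D (\<lambda>t. 1 * ln (N t) + (- 1) * ln (Q t))"
    by (intro smooth_on_add smooth_on_mult smooth_on_const sm D)
  then show "smooth_on D w"
    by (rule smooth_on_cong[OF D]) (simp add: w_eq)
  show expw: "exp (w t) = 4 * (cmod (deriv g t))\<^sup>2 / (1 - (cmod (g t))\<^sup>2)\<^sup>2" if "t \<in> D" for t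
    using pos[OF that] by (simp add: w_def flip: N_def Q_def)
  have rg: "rgrad w (A t) t" if t: "t \<in> D" for t
  proof -
    note wi = wirt_intros wirt_holomorphic_on[OF hol D t] wirt_holomorphic_on[OF holg(1) D t]
    have "wirt (\<lambda>t. 4 * (deriv g t * cnj (deriv g t)))
        (4 * (deriv (deriv g) t * cnj (deriv g t))) (cnj (4 * (deriv (deriv g) t * cnj (deriv g t)))) t"
      by (rule wirt_eq_rhs, (rule wi)+) simp_all
    from wirt_imp_rgrad[OF this]
    have "rgrad N (4 * (deriv (deriv g) t * cnj (deriv g t))) t"
      unfolding N_eq[abs_def] .
    from rgrad_chain[OF this DERIV_ln_divide[OF pos(1)[OF t]]]
    have 1: "rgrad (\<lambda>t. ln (N t)) (deriv (deriv g) t * inverse (deriv g t)) t"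
      using nz(1)[OF t] by (simp add: of_real_divide cN field_simps)
    have "wirt (\<lambda>t. (1 - g t * cnj (g t)) * (1 - g t * cnj (g t)))
        (- 2 * (1 - g t * cnj (g t)) * (deriv g t * cnj (g t)))
        (cnj (- 2 * (1 - g t * cnj (g t)) * (deriv g t * cnj (g t)))) t"
      by (rule wirt_eq_rhs, (rule wi)+) (simp_all add: algebra_simps)
    from wirt_imp_rgrad[OF this]
    have "rgrad Q (- 2 * (1 - g t * cnj (g t)) * (deriv g t * cnj (g t))) t"
      unfolding Q_eq[abs_def] .
    from rgrad_chain[OF this DERIV_ln_divide[OF pos(2)[OF t]]]
    have "rgrad (\<lambda>t. ln (Q t)) (of_real (1 / Q t) * (- 2 * (1 - g t * cnj (g t)) * (deriv g t * cnj (g t)))) t" .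
    moreover have "of_real (1 / Q t) * (- 2 * (1 - g t * cnj (g t)) * (deriv g t * cnj (g t)))
      = - 2 * (deriv g t * cnj (g t)) * inverse (1 - g t * cnj (g t))"
    proof -
      have "1 / (x * x) * (- 2 * x * y) = - 2 * y * inverse x" if "x \<noteq> 0" for x y :: complex
        using that by (simp add: field_simps)
      from this[OF d1[OF t]] show ?thesis unfolding of_real_divide of_real_1 cQ .
    qed
    ultimately have 2: "rgrad (\<lambda>t. ln (Q t)) (- 2 * (deriv g t * cnj (g t)) * inverse (1 - g t * cnj (g t))) t"
      by simp
    have "rgrad (\<lambda>t. 1 * ln (N t) + (- 1) * ln (Q t)) (A t) t"
      using rgrad_linear_comb[OF 1 2, of 1 "-1"] by (simp add: A_def)
    then show ?thesis
      by (rule rgrad_transform_open[OF D t]) (simp add: w_eq)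
  qed
  show "laplacian w t = 2 * exp (w t)" if t: "t \<in> D" for t
  proof -
    define x where "x = 1 - g t * cnj (g t)"
    have x: "x \<noteq> 0" using d1[OF t] by (simp add: x_def)
    note wi = wirt_intros wirt_holomorphic_on[OF hol D t] wirt_holomorphic_on[OF holg(1) D t]
      wirt_holomorphic_on[OF holg(2) D t]
    \<comment> \<open>The Laplacian reads off the conjugate coefficient alone, so the other one is
      left to unification.\<close>
    have "\<exists>a. wirt A a (2 * (deriv g t * cnj (deriv g t)) * inverse x
        + 2 * (deriv g t * cnj (g t)) * (g t * cnj (deriv g t)) / x\<^sup>2) t"
      unfolding A_def[abs_def]
      by (rule exI, rule wirt_eq_rhs, (rule wi d1[OF t] nz(1)[OF t])+, rule refl) (simp add: x_def)
    then obtain a where a: "wirt A a (2 * (deriv g t * cnj (deriv g t)) * inverse x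
        + 2 * (deriv g t * cnj (g t)) * (g t * cnj (deriv g t)) / x\<^sup>2) t" ..
    \<comment> \<open>Over the common denominator the numerator contains
      \<open>x + g t * cnj (g t)\<close>, which is 1 by the choice of \<open>x\<close>.\<close>
    have "2 * (deriv g t * cnj (deriv g t)) * inverse x
        + 2 * (deriv g t * cnj (g t)) * (g t * cnj (deriv g t)) / x\<^sup>2
      = 2 * (deriv g t * cnj (deriv g t)) * (x + g t * cnj (g t)) / (x * x)"
      using x by (simp add: field_simps power2_eq_square)
    also have "\<dots> = of_real (N t / (2 * Q t))"
      unfolding of_real_divide of_real_mult cN cQ x_def by simp
    finally have "laplacian w t = 4 * Re (of_real (N t / (2 * Q t)))"
      using laplacian_wirt[OF D t rg a] by simp
    also have "\<dots> = 2 * exp (w t)"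
      unfolding expw[OF t] N_def Q_def Re_complex_of_real by simp
    finally show ?thesis .
  qed
qed

section \<open>Decoupling the natural system\<close>

text \<open>With \<open>P\<close> and \<open>M\<close> as coordinates, positivity is automatic,
  \<open>X = (P + M) / 4\<close> and \<open>Y = (P - M) / 2\<close>; this is where the weights
  \<open>3/4\<close> and \<open>-1/4\<close> of \<open>X + Y\<close> and \<open>X - Y\<close> come
  from. As an equivalence it serves both directions of the theorem.\<close>

lemma natural_system_iff_liouville:
  fixes K \<kappa> P M :: "complex \<Rightarrow> real"
  assumes D: "open D" and sm: "smooth_on D P" "smooth_on D M"
    and P: "\<And>t. t \<in> D \<Longrightarrow> K t + \<kappa> t = exp (P t)" and M: "\<And>t. t \<in> D \<Longrightarrow> K t - \<kappa> t = exp (M t)"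
  shows "natural_system_solution D K \<kappa> \<longleftrightarrow> (\<forall>t\<in>D.
      laplacian (\<lambda>s. 3/4 * P s + (-1/4) * M s) t = 2 * exp (3/4 * P t + (-1/4) * M t) \<and>
      laplacian (\<lambda>s. 3/4 * M s + (-1/4) * P s) t = 2 * exp (3/4 * M t + (-1/4) * P t))"
proof -
  have smexp: "smooth_on D (\<lambda>t. exp (f t))" if "smooth_on D f" for f :: "complex \<Rightarrow> real"
    by (rule smooth_on_compose_real[OF D open_UNIV _ smooth_on_exp that]) simp
  have "smooth_on D (\<lambda>t. 1/2 * exp (P t) + 1/2 * exp (M t))" "smooth_on D (\<lambda>t. 1/2 * exp (P t) - 1/2 * exp (M t))"
    by (intro smooth_on_add smooth_on_diff smooth_on_mult smooth_on_const smexp sm D)+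
  moreover have "1/2 * exp (P t) + 1/2 * exp (M t) = K t" "1/2 * exp (P t) - 1/2 * exp (M t) = \<kappa> t" if "t \<in> D" for t
    unfolding P[OF that, symmetric] M[OF that, symmetric] by (simp_all add: field_simps)
  ultimately have smK: "smooth_on D K" "smooth_on D \<kappa>"
    by (auto elim: smooth_on_cong[OF D])
  have prod: "(K t)\<^sup>2 - (\<kappa> t)\<^sup>2 = exp (P t + M t)" and Kpos: "K t > 0" if "t \<in> D" for t
  proof -
    have "(K t)\<^sup>2 - (\<kappa> t)\<^sup>2 = (K t + \<kappa> t) * (K t - \<kappa> t)"
      by (simp add: power2_eq_square algebra_simps)
    then show "(K t)\<^sup>2 - (\<kappa> t)\<^sup>2 = exp (P t + M t)"
      using P[OF that] M[OF that] by (simp add: exp_add)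
    show "K t > 0"
      using P[OF that] M[OF that] exp_gt_zero[of "P t"] exp_gt_zero[of "M t"] by linarith
  qed
  have ln4: "ln (root 4 ((K t)\<^sup>2 - (\<kappa> t)\<^sup>2)) = 1/4 * P t + 1/4 * M t" if "t \<in> D" for t
    unfolding prod[OF that] by (simp add: ln_root)
  have root4: "root 4 ((K t)\<^sup>2 - (\<kappa> t)\<^sup>2) = exp (1/4 * P t + 1/4 * M t)" if "t \<in> D" for t
    unfolding ln4[OF that, symmetric] using prod[OF that] by simp
  have lnq: "ln (sqrt ((K t + \<kappa> t) / (K t - \<kappa> t))) = 1/2 * P t + (-1/2) * M t" if "t \<in> D" for t
    unfolding P[OF that] M[OF that] by (simp add: ln_sqrt ln_div)
  have lap1: "laplacian (\<lambda>s. ln (root 4 ((K s)\<^sup>2 - (\<kappa> s)\<^sup>2))) t = 1/4 * laplacian P t + 1/4 * laplacian M t"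
    if t: "t \<in> D" for t
    unfolding laplacian_linear_comb[OF D t sm, symmetric]
    by (rule laplacian_cong[OF D t]) (intro smooth_on_add smooth_on_mult smooth_on_const sm D, simp only: ln4)
  have lap2: "laplacian (\<lambda>s. ln (sqrt ((K s + \<kappa> s) / (K s - \<kappa> s)))) t = 1/2 * laplacian P t + (-1/2) * laplacian M t"
    if t: "t \<in> D" for t
    unfolding laplacian_linear_comb[OF D t sm, symmetric]
    by (rule laplacian_cong[OF D t]) (intro smooth_on_add smooth_on_mult smooth_on_const sm D, simp only: lnq)
  have "(root 4 ((K t)\<^sup>2 - (\<kappa> t)\<^sup>2) * laplacian (\<lambda>s. ln (root 4 ((K s)\<^sup>2 - (\<kappa> s)\<^sup>2))) t = 2 * K t \<and>
       root 4 ((K t)\<^sup>2 - (\<kappa> t)\<^sup>2) * laplacian (\<lambda>s. ln (sqrt ((K s + \<kappa> s) / (K s - \<kappa> s)))) t = 2 * \<kappa> t)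
     \<longleftrightarrow> laplacian (\<lambda>s. 3/4 * P s + (-1/4) * M s) t = 2 * exp (3/4 * P t + (-1/4) * M t) \<and>
      laplacian (\<lambda>s. 3/4 * M s + (-1/4) * P s) t = 2 * exp (3/4 * M t + (-1/4) * P t)"
    if t: "t \<in> D" for t
  proof -
    \<comment> \<open>This is the fourth root; multiplying the Liouville right-hand sides by it
      restores \<open>K t + \<kappa> t\<close> and \<open>K t - \<kappa> t\<close>.\<close>
    define \<rho> where "\<rho> = exp (1/4 * P t + 1/4 * M t)"
    have \<rho>: "\<rho> > 0" by (simp add: \<rho>_def)
    have e: "exp (3/4 * P t + (-1/4) * M t) * \<rho> = K t + \<kappa> t" "exp (3/4 * M t + (-1/4) * P t) * \<rho> = K t - \<kappa> t"
      unfolding P[OF t] M[OF t] \<rho>_def exp_add[symmetric] by (simp_all add: field_simps)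
    \<comment> \<open>Passing to the sum and the difference of the two equations is invertible, so
      nothing is lost in either direction.\<close>
    have combine: "(1/4 * x + 1/4 * y = 2 * k \<and> 1/2 * x + (-1/2) * y = 2 * l) \<longleftrightarrow>
        (3/4 * x + (-1/4) * y = 2 * (k + l) \<and> 3/4 * y + (-1/4) * x = 2 * (k - l))" for x y k l :: real
    proof
      assume *: "1/4 * x + 1/4 * y = 2 * k \<and> 1/2 * x + (-1/2) * y = 2 * l"
      show "3/4 * x + (-1/4) * y = 2 * (k + l) \<and> 3/4 * y + (-1/4) * x = 2 * (k - l)"
        using conjunct1[OF *] conjunct2[OF *] by auto
    next
      assume *: "3/4 * x + (-1/4) * y = 2 * (k + l) \<and> 3/4 * y + (-1/4) * x = 2 * (k - l)"
      show "1/4 * x + 1/4 * y = 2 * k \<and> 1/2 * x + (-1/2) * y = 2 * l"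
        using conjunct1[OF *] conjunct2[OF *] by auto
    qed
    have pull: "\<rho> * (\<alpha> * x + \<beta> * y) = \<alpha> * (\<rho> * x) + \<beta> * (\<rho> * y)" for \<alpha> \<beta> x y
      by (simp add: algebra_simps)
    have scale: "\<alpha> * x + \<beta> * y = 2 * exp z \<longleftrightarrow> \<alpha> * (\<rho> * x) + \<beta> * (\<rho> * y) = 2 * (exp z * \<rho>)" for \<alpha> \<beta> x y z
      unfolding pull[symmetric] using \<rho> by auto
    show ?thesis
      unfolding laplacian_linear_comb[OF D t sm] laplacian_linear_comb[OF D t sm(2,1)]
        lap1[OF t] lap2[OF t] root4[OF t] \<rho>_def[symmetric] scale e pull by (rule combine)
  qed
  then show ?thesis
    unfolding natural_system_solution_def using smK prod Kpos by simp
qed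

text \<open>The exponents invert the change from \<open>P\<close>, \<open>M\<close> to the two
  Liouville functions. Square roots of the hypotheses produce absolute values of the denominators;
  the sign condition is what lets their product be replaced by the signed product in the
  formulas.\<close>

lemma formulas_eq_exp:
  assumes "exp a = 4 * (cmod (deriv g1 t))\<^sup>2 / (1 - (cmod (g1 t))\<^sup>2)\<^sup>2"
    and "exp b = 4 * (cmod (deriv g2 t))\<^sup>2 / (1 - (cmod (g2 t))\<^sup>2)\<^sup>2"
    and "((cmod (g1 t))\<^sup>2 - 1) * ((cmod (g2 t))\<^sup>2 - 1) > 0"
  shows "K_formula g1 g2 t + kappa_formula g1 g2 t = exp (1/2 * a + 3/2 * b)"
    and "K_formula g1 g2 t - kappa_formula g1 g2 t = exp (3/2 * a + 1/2 * b)"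
proof -
  define d1 where "d1 = (cmod (g1 t))\<^sup>2 - 1"
  define d2 where "d2 = (cmod (g2 t))\<^sup>2 - 1"
  define x where "x = cmod (deriv g1 t)"
  define y where "y = cmod (deriv g2 t)"
  have half: "exp (c / 2) = 2 * z / \<bar>d\<bar>" if "exp c = 4 * z\<^sup>2 / (- d)\<^sup>2" "z \<ge> 0" for c z d :: real
  proof (rule power2_eq_imp_eq)
    show "(exp (c / 2))\<^sup>2 = (2 * z / \<bar>d\<bar>)\<^sup>2"
      using that(1) by (simp add: power_divide power_mult_distrib flip: exp_double)
  qed (use that in auto)
  have a: "exp (a / 2) = 2 * x / \<bar>d1\<bar>" and b: "exp (b / 2) = 2 * y / \<bar>d2\<bar>"
    using assms by (auto intro!: half simp: x_def y_def d1_def d2_def)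
  have d: "d1 * d2 > 0" "\<bar>d1\<bar> * \<bar>d2\<bar> = d1 * d2"
    using assms(3) by (auto simp: d1_def d2_def simp flip: abs_mult)
  have cube: "exp (1/2 * c + 3/2 * e) = exp (c / 2) * exp (e / 2) * (exp (e / 2))\<^sup>2" for c e :: real
    by (simp add: power2_eq_square flip: exp_add)
  have K: "K_formula g1 g2 t = 8 * (x * y) / (d1 * d2) * (x\<^sup>2 / d1\<^sup>2 + y\<^sup>2 / d2\<^sup>2)"
    and \<kappa>: "kappa_formula g1 g2 t = - 8 * (x * y) / (d1 * d2) * (x\<^sup>2 / d1\<^sup>2 - y\<^sup>2 / d2\<^sup>2)"
    by (simp_all add: K_formula_def kappa_formula_def x_def y_def d1_def d2_def norm_mult)
  have ab: "exp (a / 2) * exp (b / 2) = 4 * (x * y) / (d1 * d2)"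
    unfolding a b d(2)[symmetric] by simp
  have "exp (1/2 * a + 3/2 * b) = 4 * (x * y) / (d1 * d2) * (4 * y\<^sup>2 / d2\<^sup>2)"
    unfolding cube ab unfolding b by (simp add: power_divide power_mult_distrib)
  then show "K_formula g1 g2 t + kappa_formula g1 g2 t = exp (1/2 * a + 3/2 * b)"
    unfolding K \<kappa> by (simp add: algebra_simps)
  have "exp (1/2 * b + 3/2 * a) = 4 * (x * y) / (d1 * d2) * (4 * x\<^sup>2 / d1\<^sup>2)"
    unfolding cube mult.commute[of "exp (b / 2)"] ab unfolding a by (simp add: power_divide power_mult_distrib)
  then show "K_formula g1 g2 t - kappa_formula g1 g2 t = exp (3/2 * a + 1/2 * b)"
    unfolding K \<kappa> by (simp add: algebra_simps)
qed

lemma natural_system_solution_local: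
  assumes D: "open D" and sol: "natural_system_solution D K \<kappa>" and "p \<in> D"
  shows "\<exists>D0 g1 g2. open D0 \<and> p \<in> D0 \<and> D0 \<subseteq> D \<and> admissible_pair D0 g1 g2 \<and>
    (\<forall>t\<in>D0. K t = K_formula g1 g2 t \<and> \<kappa> t = kappa_formula g1 g2 t)"
proof -
  define P where "P t = ln (K t + \<kappa> t)" for t
  define M where "M t = ln (K t - \<kappa> t)" for t
  have pos: "K t + \<kappa> t > 0" "K t - \<kappa> t > 0" if "t \<in> D" for t
  proof -
    have "(K t)\<^sup>2 - (\<kappa> t)\<^sup>2 > 0" "K t > 0"
      using sol that by (auto simp: natural_system_solution_def)
    then have "\<bar>\<kappa> t\<bar> < K t"
      using power2_less_imp_less[of "\<bar>\<kappa> t\<bar>" "K t"] by simp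
    then show "K t + \<kappa> t > 0" "K t - \<kappa> t > 0" by linarith+
  qed
  have "smooth_on D K" "smooth_on D \<kappa>"
    using sol by (auto simp: natural_system_solution_def)
  then have sm: "smooth_on D P" "smooth_on D M"
    unfolding P_def[abs_def] M_def[abs_def]
    using smooth_on_ln_compose[OF D smooth_on_add[OF D]] smooth_on_ln_compose[OF D smooth_on_diff[OF D]] pos
    by blast+
  have PM: "K t + \<kappa> t = exp (P t)" "K t - \<kappa> t = exp (M t)" if "t \<in> D" for t
    using pos[OF that] by (simp_all add: P_def M_def)
  \<comment> \<open>\<open>w1\<close> is \<open>X - Y\<close> and \<open>w2\<close> is
    \<open>X + Y\<close>: in the target formulas \<open>K - \<kappa>\<close> carries the cube of the
    \<open>g1\<close> factor, and \<open>K + \<kappa>\<close> that of the \<open>g2\<close>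
    factor.\<close>
  define w1 where "w1 t = 3/4 * M t + (-1/4) * P t" for t
  define w2 where "w2 t = 3/4 * P t + (-1/4) * M t" for t
  have w: "laplacian w1 t = 2 * exp (w1 t)" "laplacian w2 t = 2 * exp (w2 t)" if "t \<in> D" for t
    using natural_system_iff_liouville[OF D sm PM] sol that
    unfolding w1_def[abs_def] w2_def[abs_def] by blast+
  have smw: "smooth_on D w1" "smooth_on D w2"
    unfolding w1_def[abs_def] w2_def[abs_def]
    by (intro smooth_on_add smooth_on_mult smooth_on_const sm D)+
  obtain r1 g1 where g1: "r1 > 0" "ball p r1 \<subseteq> D" "g1 holomorphic_on ball p r1"
    "\<And>t. t \<in> ball p r1 \<Longrightarrow> deriv g1 t \<noteq> 0" "\<And>t. t \<in> ball p r1 \<Longrightarrow> cmod (g1 t) < 1"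
    "\<And>t. t \<in> ball p r1 \<Longrightarrow> exp (w1 t) = 4 * (cmod (deriv g1 t))\<^sup>2 / (1 - (cmod (g1 t))\<^sup>2)\<^sup>2"
    using liouville_representation[OF D smw(1) w(1) \<open>p \<in> D\<close>] by blast
  obtain r2 g2 where g2: "r2 > 0" "ball p r2 \<subseteq> D" "g2 holomorphic_on ball p r2"
    "\<And>t. t \<in> ball p r2 \<Longrightarrow> deriv g2 t \<noteq> 0" "\<And>t. t \<in> ball p r2 \<Longrightarrow> cmod (g2 t) < 1"
    "\<And>t. t \<in> ball p r2 \<Longrightarrow> exp (w2 t) = 4 * (cmod (deriv g2 t))\<^sup>2 / (1 - (cmod (g2 t))\<^sup>2)\<^sup>2"
    using liouville_representation[OF D smw(2) w(2) \<open>p \<in> D\<close>] by blast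
  define D0 where "D0 = ball p (min r1 r2)"
  have D0: "D0 \<subseteq> ball p r1" "D0 \<subseteq> ball p r2" by (auto simp: D0_def)
  have prod: "((cmod (g1 t))\<^sup>2 - 1) * ((cmod (g2 t))\<^sup>2 - 1) > 0" if "t \<in> D0" for t
  proof -
    have "cmod (g1 t) < 1" "cmod (g2 t) < 1" using g1(5) g2(5) D0 that by blast+
    then have "(cmod (g1 t))\<^sup>2 < 1" "(cmod (g2 t))\<^sup>2 < 1" by (simp_all add: abs_square_less_1)
    then show ?thesis by (intro mult_neg_neg) auto
  qed
  have "admissible_pair D0 g1 g2"
    unfolding admissible_pair_def
    using holomorphic_on_subset[OF g1(3) D0(1)] holomorphic_on_subset[OF g2(3) D0(2)] g1(4) g2(4) D0 prod
    by auto
  moreover have "K t = K_formula g1 g2 t \<and> \<kappa> t = kappa_formula g1 g2 t" if t: "t \<in> D0" for t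
  proof -
    have "t \<in> ball p r1" "t \<in> ball p r2" "t \<in> D" using t D0 g1(2) by auto
    note f = formulas_eq_exp[OF g1(6)[OF this(1)] g2(6)[OF this(2)] prod[OF t]]
    have "1/2 * w1 t + 3/2 * w2 t = P t" "3/2 * w1 t + 1/2 * w2 t = M t"
      by (simp_all add: w1_def w2_def field_simps)
    then have "K_formula g1 g2 t + kappa_formula g1 g2 t = K t + \<kappa> t"
      "K_formula g1 g2 t - kappa_formula g1 g2 t = K t - \<kappa> t"
      using f PM[OF \<open>t \<in> D\<close>] by simp_all
    then show ?thesis by linarith
  qed
  moreover have "open D0" "p \<in> D0" "D0 \<subseteq> D"
    using g1(1,2) g2(1) D0 by (auto simp: D0_def)
  ultimately show ?thesis by blast
qed

lemma admissible_pair_solution: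
  assumes D: "open D" and adm: "admissible_pair D g1 g2"
  shows "natural_system_solution D (K_formula g1 g2) (kappa_formula g1 g2)"
proof -
  have hol: "g1 holomorphic_on D" "g2 holomorphic_on D"
    and nz: "\<And>t. t \<in> D \<Longrightarrow> deriv g1 t \<noteq> 0" "\<And>t. t \<in> D \<Longrightarrow> deriv g2 t \<noteq> 0"
    and prod: "\<And>t. t \<in> D \<Longrightarrow> ((cmod (g1 t))\<^sup>2 - 1) * ((cmod (g2 t))\<^sup>2 - 1) > 0"
    using adm by (auto simp: admissible_pair_def)
  have ne: "(cmod (g1 t))\<^sup>2 \<noteq> 1" "(cmod (g2 t))\<^sup>2 \<noteq> 1" if "t \<in> D" for t
    using prod[OF that] by auto
  define w1 where "w1 t = ln (4 * (cmod (deriv g1 t))\<^sup>2 / (1 - (cmod (g1 t))\<^sup>2)\<^sup>2)" for t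
  define w2 where "w2 t = ln (4 * (cmod (deriv g2 t))\<^sup>2 / (1 - (cmod (g2 t))\<^sup>2)\<^sup>2)" for t
  have L1: "smooth_on D w1" "\<And>t. t \<in> D \<Longrightarrow> laplacian w1 t = 2 * exp (w1 t)"
    "\<And>t. t \<in> D \<Longrightarrow> exp (w1 t) = 4 * (cmod (deriv g1 t))\<^sup>2 / (1 - (cmod (g1 t))\<^sup>2)\<^sup>2"
    by (rule liouville_solution[OF D hol(1) nz(1) ne(1), folded w1_def]; assumption)+
  have L2: "smooth_on D w2" "\<And>t. t \<in> D \<Longrightarrow> laplacian w2 t = 2 * exp (w2 t)"
    "\<And>t. t \<in> D \<Longrightarrow> exp (w2 t) = 4 * (cmod (deriv g2 t))\<^sup>2 / (1 - (cmod (g2 t))\<^sup>2)\<^sup>2"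
    by (rule liouville_solution[OF D hol(2) nz(2) ne(2), folded w2_def]; assumption)+
  \<comment> \<open>The inverse of the linear change that defines the Liouville functions from
    \<open>P\<close> and \<open>M\<close>; the weights match the exponents in
    \<open>formulas_eq_exp\<close>.\<close>
  define P where "P t = 1/2 * w1 t + 3/2 * w2 t" for t
  define M where "M t = 3/2 * w1 t + 1/2 * w2 t" for t
  have sm: "smooth_on D P" "smooth_on D M"
    unfolding P_def[abs_def] M_def[abs_def]
    by (intro smooth_on_add smooth_on_mult smooth_on_const L1(1) L2(1) D)+
  have PM: "K_formula g1 g2 t + kappa_formula g1 g2 t = exp (P t)"
    "K_formula g1 g2 t - kappa_formula g1 g2 t = exp (M t)" if "t \<in> D" for t
    using formulas_eq_exp[OF L1(3)[OF that] L2(3)[OF that] prod[OF that]] by (simp_all add: P_def M_def)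
  have w: "3/4 * P t + (-1/4) * M t = w2 t" "3/4 * M t + (-1/4) * P t = w1 t" for t
    by (simp_all add: P_def M_def field_simps)
  show ?thesis
  proof (rule iffD2[OF natural_system_iff_liouville[OF D sm]])
    show "\<forall>t\<in>D. laplacian (\<lambda>s. 3/4 * P s + (-1/4) * M s) t = 2 * exp (3/4 * P t + (-1/4) * M t) \<and>
      laplacian (\<lambda>s. 3/4 * M s + (-1/4) * P s) t = 2 * exp (3/4 * M t + (-1/4) * P t)"
      unfolding w using L1(2) L2(2) by blast
  qed (simp_all add: PM)
qed

theorem theorem11p4:
  fixes D :: "complex set"
  assumes "open D" and "connected D" and "D \<noteq> {}"
  shows "(\<forall>K \<kappa>. natural_system_solution D K \<kappa> \<longrightarrow>
            (\<forall>p0\<in>D. \<exists>D0 g1 g2.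
               open D0 \<and> p0 \<in> D0 \<and> D0 \<subseteq> D \<and> admissible_pair D0 g1 g2 \<and>
               (\<forall>t\<in>D0. K t = K_formula g1 g2 t \<and> \<kappa> t = kappa_formula g1 g2 t)))
       \<and> (\<forall>g1 g2. admissible_pair D g1 g2 \<longrightarrow>
            natural_system_solution D (K_formula g1 g2) (kappa_formula g1 g2))"
proof (intro conjI allI impI ballI)
  fix K \<kappa> p0
  assume "natural_system_solution D K \<kappa>" "p0 \<in> D"
  then show "\<exists>D0 g1 g2. open D0 \<and> p0 \<in> D0 \<and> D0 \<subseteq> D \<and> admissible_pair D0 g1 g2 \<and>
      (\<forall>t\<in>D0. K t = K_formula g1 g2 t \<and> \<kappa> t = kappa_formula g1 g2 t)"
    by (rule natural_system_solution_local[OF assms(1)])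
qed (rule admissible_pair_solution[OF assms(1)])

end
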